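(* Let $G$ be a finite group. If $\lambda(G)<\frac32$, then $\lambda(G)=1$, and $G$ is cyclic of squarefree order.
   Context: For a finite group $G$, $\mathrm{sub}(G)$ denotes the number of subgroups of $G$ (including the trivial subgroup and $G$), $\pi(G)$ denotes the number of distinct prime divisors of $|G|$ (so $\pi(1)=0$), and $\lambda(G)=\mathrm{sub}(G)/2^{\pi(G)}$. The trivial group counts as cyclic of squarefree order $1$. *)

theory Defs
  imports Complex_Main
    "HOL-Algebra.Elementary_Groups"
    "HOL-Computational_Algebra.Squarefree"
begin

(* The definitions are meant for finite groups; for an infinite carrier order G is 0,
   so num_primes G is 0. *)

definition num_subgroups :: "('a, 'b) monoid_scheme \<Rightarrow> nat" where
  "num_subgroups G = card {H. subgroup H G}"

definition num_primes :: "('a, 'b) monoid_scheme \<Rightarrow> nat" where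
  "num_primes G = card (prime_factors (order G))"

definition subgroup_ratio :: "('a, 'b) monoid_scheme \<Rightarrow> real" where
  "subgroup_ratio G = real (num_subgroups G) / 2 ^ num_primes G"

end

theory Submission
  imports Defs
    "HOL-Algebra.Multiplicative_Group"
    "HOL-Algebra.Group_Action"
    "HOL-Algebra.Sylow"
    "HOL-Algebra.Zassenhaus"
    "HOL-Number_Theory.Totient"
begin

text \<open>By a theorem of Frobenius, the number of solutions of x^d = 1 in G is a multiple of d for
  every divisor d of n = |G|. Richards deduced that G has at least as many cyclic subgroups as n has
  divisors. If n is not squarefree, this already gives three halves of 2^k subgroups, where k is the
  number of primes dividing n. If n is squarefree, Frobenius' theorem
  yields a normal subgroup P of order p for the largest prime p, and P has a complement K. For every
  subgroup H of K both H and PH are subgroups of G, so the ratio of G is at least that of K, and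
  induction settles the case that K is not cyclic. If K is cyclic but G is not, at least half of the
  subgroups of K do not centralize P, and each of these has p conjugates under P.\<close>

section \<open>Solutions of power equations and Frobenius' theorem\<close>

text \<open>A group need not have a subgroup of every order dividing \<open>n\<close> (the
  alternating group of degree 4 has none of order 6), so divisors cannot be sent to subgroups
  directly. Richards' bound compares two totals instead, and Frobenius' theorem makes the comparison
  go in the right direction. The constant 3/2 is sharp: a prime with exponent \<open>e\<close>
  contributes a factor \<open>e + 1\<close> to the number of divisors against 2 in
  \<open>2^k\<close>, which is 3/2 for \<open>e = 2\<close> and is attained by the cyclic group of
  order \<open>p^2\<close>; the symmetric group of degree 3 attains it too, with 6 subgroups against
  \<open>2^2\<close>. For squarefree order the number of divisors is exactly \<open>2^k\<close>, so
  Richards' bound alone gives only ratio at least 1. The missing half has to come from conjugates,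
  of which there are at least three because the largest prime is odd once \<open>G\<close> is not
  cyclic.\<close>

definition root_set :: "('a, 'b) monoid_scheme \<Rightarrow> nat \<Rightarrow> 'a set" where
  "root_set G d = {x \<in> carrier G. x [^]\<^bsub>G\<^esub> d = \<one>\<^bsub>G\<^esub>}"

text \<open>Only a set; as a group it is \<open>G\<lparr>carrier := centralizer G z\<rparr>\<close>.
  The group is an argument of \<open>root_set\<close> so that equations can be solved inside such a
  centralizer.\<close>

definition centralizer :: "('a, 'b) monoid_scheme \<Rightarrow> 'a \<Rightarrow> 'a set" where
  "centralizer G z = {g \<in> carrier G. g \<otimes>\<^bsub>G\<^esub> z = z \<otimes>\<^bsub>G\<^esub> g}"

definition conj_class :: "('a, 'b) monoid_scheme \<Rightarrow> 'a \<Rightarrow> 'a set" where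
  "conj_class G z = (\<lambda>g. g \<otimes>\<^bsub>G\<^esub> z \<otimes>\<^bsub>G\<^esub> inv\<^bsub>G\<^esub> g) ` carrier G"

text \<open>A partition is represented by the map \<open>cl\<close> from a point to its class, and a
  class contributes its size times the common value of \<open>F\<close>. The classes will be
  conjugacy classes in one use, sets of generators of a cyclic subgroup in the other.\<close>

lemma dvd_sum_over_classes:
  fixes F :: "'a \<Rightarrow> nat"
  assumes fin: "finite A"
    and self: "\<And>x. x \<in> A \<Longrightarrow> x \<in> cl x"
    and sub: "\<And>x. x \<in> A \<Longrightarrow> cl x \<subseteq> A"
    and eq: "\<And>x y. x \<in> A \<Longrightarrow> y \<in> cl x \<Longrightarrow> cl y = cl x"
    and const: "\<And>x y. x \<in> A \<Longrightarrow> y \<in> cl x \<Longrightarrow> F y = F x"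
    and k: "\<And>x. x \<in> A \<Longrightarrow> k dvd card (cl x) * F x"
  shows "k dvd sum F A"
proof -
  have "A = \<Union>(cl ` A)" using self sub by auto
  hence "sum F A = sum F (\<Union>(cl ` A))" by simp
  also have "\<dots> = (\<Sum>C\<in>cl ` A. sum F C)"
  proof (subst sum.Union_disjoint)
    show "\<forall>C\<in>cl ` A. finite C" using sub fin by (auto intro: finite_subset)
    show "\<forall>C\<in>cl ` A. \<forall>D\<in>cl ` A. C \<noteq> D \<longrightarrow> C \<inter> D = {}" using eq by blast
  qed simp
  also have "k dvd \<dots>"
  proof (rule dvd_sum, clarify)
    fix x assume x: "x \<in> A"
    have "sum F (cl x) = card (cl x) * F x" using const[OF x] by simp
    thus "k dvd sum F (cl x)" using k[OF x] by simp
  qed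
  finally show ?thesis .
qed

section \<open>Centralizers, conjugacy classes and coprime factors of an element\<close>

context group
begin

lemma subgroup_centralizer:
  assumes "z \<in> carrier G" shows "subgroup (centralizer G z) G"
proof (rule subgroupI)
  show "centralizer G z \<subseteq> carrier G" by (auto simp: centralizer_def)
  show "centralizer G z \<noteq> {}" using assms by (auto simp: centralizer_def)
next
  fix a assume a: "a \<in> centralizer G z"
  hence [simp]: "a \<in> carrier G" and c: "a \<otimes> z = z \<otimes> a" by (auto simp: centralizer_def)
  have "inv a \<otimes> z = inv a \<otimes> (z \<otimes> a) \<otimes> inv a" using assms by (simp add: m_assoc)
  also have "\<dots> = inv a \<otimes> (a \<otimes> z) \<otimes> inv a" using c by simp
  also have "\<dots> = z \<otimes> inv a" using assms by (simp add: m_assoc[symmetric])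
  finally show "inv a \<in> centralizer G z" by (simp add: centralizer_def)
next
  fix a b assume "a \<in> centralizer G z" "b \<in> centralizer G z"
  hence ab: "a \<in> carrier G" "b \<in> carrier G" "a \<otimes> z = z \<otimes> a" "b \<otimes> z = z \<otimes> b"
    by (auto simp: centralizer_def)
  have "a \<otimes> b \<otimes> z = a \<otimes> z \<otimes> b" using ab(1,2,4) assms by (simp add: m_assoc)
  also have "\<dots> = z \<otimes> a \<otimes> b" using ab(3) by simp
  also have "\<dots> = z \<otimes> (a \<otimes> b)" using ab(1,2) assms by (simp add: m_assoc)
  finally show "a \<otimes> b \<in> centralizer G z" using ab by (simp add: centralizer_def)
qed

lemma card_conj_class:
  assumes z: "z \<in> carrier G"
  shows "card (conj_class G z) * card (centralizer G z) = order G"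
proof -
  let ?\<phi> = "\<lambda>g. \<lambda>h \<in> carrier G. g \<otimes> h \<otimes> inv g"
  interpret group_action G "carrier G" ?\<phi> by (rule action_by_conjugation)
  have "orbit G ?\<phi> z = conj_class G z"
    using z by (auto simp: orbit_def conj_class_def)
  moreover have "stabilizer G ?\<phi> z = centralizer G z"
    using z by (auto simp: stabilizer_def centralizer_def inv_solve_right')
  ultimately show ?thesis using orbit_stabilizer_theorem[OF z] by simp
qed

lemma conj_inv_conj:
  assumes "g \<in> carrier G" "x \<in> carrier G"
  shows "inv g \<otimes> (g \<otimes> x \<otimes> inv g) \<otimes> g = x"
  using assms by (simp add: m_assoc[symmetric]) (simp add: m_assoc)

lemma conj_mult:
  assumes "g \<in> carrier G" "x \<in> carrier G" "y \<in> carrier G"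
  shows "g \<otimes> (x \<otimes> y) \<otimes> inv g = (g \<otimes> x \<otimes> inv g) \<otimes> (g \<otimes> y \<otimes> inv g)"
proof -
  have "(g \<otimes> x \<otimes> inv g) \<otimes> (g \<otimes> y \<otimes> inv g) = g \<otimes> x \<otimes> (inv g \<otimes> g) \<otimes> y \<otimes> inv g"
    using assms by (simp add: m_assoc del: l_inv) (simp add: m_assoc[symmetric])
  thus ?thesis using assms by (simp add: m_assoc)
qed

lemma conj_pow:
  assumes "g \<in> carrier G" "x \<in> carrier G"
  shows "(g \<otimes> x \<otimes> inv g) [^] (n::nat) = g \<otimes> (x [^] n) \<otimes> inv g"
  using assms by (induction n) (simp_all add: conj_mult)

lemma conj_eq_one_iff:
  assumes "g \<in> carrier G" "x \<in> carrier G"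
  shows "g \<otimes> x \<otimes> inv g = \<one> \<longleftrightarrow> x = \<one>"
  using conj_inv_conj[OF assms] assms by (metis inv_closed l_inv r_inv r_one)

lemma conj_class_self: "z \<in> carrier G \<Longrightarrow> z \<in> conj_class G z"
  unfolding conj_class_def by (rule image_eqI[where x = \<one>]) auto

lemma conj_class_eq:
  assumes z: "z \<in> carrier G" and y: "y \<in> conj_class G z"
  shows "conj_class G y = conj_class G z"
proof -
  obtain g where g: "g \<in> carrier G" "y = g \<otimes> z \<otimes> inv g" using y by (auto simp: conj_class_def)
  have "conj_class G (g \<otimes> z \<otimes> inv g) \<subseteq> conj_class G z" if "g \<in> carrier G" "z \<in> carrier G" for g z
  proof
    fix x assume "x \<in> conj_class G (g \<otimes> z \<otimes> inv g)"
    then obtain h where h: "h \<in> carrier G" "x = h \<otimes> (g \<otimes> z \<otimes> inv g) \<otimes> inv h"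
      by (auto simp: conj_class_def)
    hence "x = (h \<otimes> g) \<otimes> z \<otimes> inv (h \<otimes> g)" using that by (simp add: inv_mult_group m_assoc)
    thus "x \<in> conj_class G z" using h that by (auto simp: conj_class_def)
  qed
  from this[of g z] this[of "inv g" y] show ?thesis
    using g z conj_inv_conj[of g z] by auto
qed

lemma conj_root_set:
  assumes "g \<in> carrier G" "x \<in> root_set G d"
  shows "g \<otimes> x \<otimes> inv g \<in> root_set G d"
  using assms by (simp add: root_set_def conj_pow)

lemma conj_class_root_set:
  "z \<in> root_set G d \<Longrightarrow> conj_class G z \<subseteq> root_set G d"
  using conj_root_set by (auto simp: conj_class_def)

text \<open>Conjugation by \<open>g\<close> carries the centralizer of \<open>z\<close> onto that of
  its conjugate and respects powers. This makes the summands in the class sums below constant on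
  conjugacy classes.\<close>

lemma card_root_set_centralizer_conj:
  assumes z: "z \<in> carrier G" and y: "y \<in> conj_class G z"
  shows "card (root_set (G\<lparr>carrier := centralizer G y\<rparr>) d) = card (root_set (G\<lparr>carrier := centralizer G z\<rparr>) d)"
proof -
  obtain g where g: "g \<in> carrier G" "y = g \<otimes> z \<otimes> inv g" using y by (auto simp: conj_class_def)
  have rs: "root_set (G\<lparr>carrier := centralizer G u\<rparr>) d = centralizer G u \<inter> root_set G d" for u
    by (auto simp: root_set_def centralizer_def nat_pow_consistent[symmetric])
  have *: "g \<otimes> x \<otimes> inv g \<in> centralizer G (g \<otimes> z \<otimes> inv g) \<inter> root_set G d"
    if "g \<in> carrier G" "z \<in> carrier G" "x \<in> centralizer G z \<inter> root_set G d" for g z x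
    using that conj_root_set[of g x d] by (simp add: centralizer_def conj_mult[symmetric])
  have "bij_betw (\<lambda>x. g \<otimes> x \<otimes> inv g) (centralizer G z \<inter> root_set G d) (centralizer G y \<inter> root_set G d)"
  proof (rule bij_betw_byWitness[where f' = "\<lambda>x. inv g \<otimes> x \<otimes> g"])
    show "(\<lambda>x. g \<otimes> x \<otimes> inv g) ` (centralizer G z \<inter> root_set G d) \<subseteq> centralizer G y \<inter> root_set G d"
      using *[OF g(1) z] g(2) by blast
    show "(\<lambda>x. inv g \<otimes> x \<otimes> g) ` (centralizer G y \<inter> root_set G d) \<subseteq> centralizer G z \<inter> root_set G d"
      using *[of "inv g" y] g z conj_inv_conj[of g z] by auto
  qed (use g z conj_inv_conj[of g] conj_inv_conj[of "inv g"] in \<open>auto simp: centralizer_def\<close>)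
  from bij_betw_same_card[OF this] show ?thesis by (simp add: rs)
qed

lemma dvd_sum_conj_classes:
  fixes F :: "'a \<Rightarrow> nat"
  assumes "finite A" "A \<subseteq> carrier G"
    and "\<And>x. x \<in> A \<Longrightarrow> conj_class G x \<subseteq> A"
    and "\<And>x y. x \<in> A \<Longrightarrow> y \<in> conj_class G x \<Longrightarrow> F y = F x"
    and "\<And>x. x \<in> A \<Longrightarrow> k dvd card (conj_class G x) * F x"
  shows "k dvd sum F A"
proof (rule dvd_sum_over_classes[where cl = "conj_class G"])
  show "x \<in> conj_class G x" if "x \<in> A" for x
    using that assms(2) conj_class_self by blast
  show "conj_class G y = conj_class G x" if "x \<in> A" "y \<in> conj_class G x" for x y
    using that assms(2) conj_class_eq by blast
qed (fact assms)+

text \<open>The order of \<open>x\<close> divides \<open>a\<close>, and a power of \<open>x\<close>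
  depends only on the exponent modulo that order.\<close>

lemma pow_eq_self:
  assumes "x \<in> carrier G" "x [^] (a::nat) = \<one>" "[u = 1] (mod a)"
  shows "x [^] u = x"
proof -
  have "int (ord x) dvd int u - int 1"
    using assms pow_eq_id by (metis cong_iff_dvd_diff cong_int_iff dvd_trans int_dvd_int_iff)
  hence "[u = 1] (mod (ord x))" by (metis cong_iff_dvd_diff cong_int_iff)
  thus ?thesis using assms(1) 
    by (metis cong_iff_dvd_diff cong_int_iff int_pow_eq int_pow_int nat_pow_eone)
qed

text \<open>A solution x of x^(ab) = 1 is uniquely a product yz of commuting solutions y and z of
  y^a = 1 and z^b = 1, and y, z are powers of x.\<close>

lemma card_root_set_mult:
  assumes fin: "finite (carrier G)" and cop: "coprime a b" and pos: "a > 0" "b > 0"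
  shows "card (root_set G (a * b)) =
    (\<Sum>z\<in>root_set G b. card (root_set (G\<lparr>carrier := centralizer G z\<rparr>) a))"
proof -
  \<comment> \<open>The exponents \<open>u\<close> and \<open>v\<close> are the idempotents of the
    Chinese remainder theorem: taking the \<open>u\<close>-th power extracts the factor killed by
    \<open>a\<close>, the \<open>v\<close>-th power the factor killed by \<open>b\<close>.\<close>
  obtain u where u: "[u = 1] (mod a)" "[u = 0] (mod b)"
    using binary_chinese_remainder_nat[OF cop] by blast
  obtain v where v: "[v = 0] (mod a)" "[v = 1] (mod b)"
    using binary_chinese_remainder_nat[OF cop] by blast
  have uv: "[u + v = 1] (mod (a * b))"
  proof -
    have "[u + v = 1 + 0] (mod a)" "[u + v = 0 + 1] (mod b)"
      using u v by (blast intro: cong_add)+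
    thus ?thesis using cop by (simp add: coprime_cong_mult_nat)
  qed
  have dv: "b dvd u" "a dvd v" using u v by (auto simp: cong_0_iff)
  let ?S = "Sigma (root_set G b) (\<lambda>z. root_set (G\<lparr>carrier := centralizer G z\<rparr>) a)"
  have S: "(z, y) \<in> ?S \<longleftrightarrow> z \<in> carrier G \<and> z [^] b = \<one> \<and> y \<in> carrier G \<and> y \<otimes> z = z \<otimes> y \<and> y [^] a = \<one>" for z y
    by (auto simp: root_set_def centralizer_def nat_pow_consistent[symmetric])
  have pow1: "x [^] (i * j) = \<one>" if "x \<in> carrier G" "x [^] i = \<one>" for x and i j :: nat
    using that by (simp add: nat_pow_pow[symmetric])
  have pow1': "x [^] j = \<one>" if "x \<in> carrier G" "x [^] i = \<one>" "i dvd j" for x and i j :: nat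
    using that pow1 by auto
  have distr: "(y \<otimes> z) [^] n = y [^] n \<otimes> z [^] n" if "y \<in> carrier G" "z \<in> carrier G" "y \<otimes> z = z \<otimes> y" for y z and n :: nat
    using that by (intro pow_mult_distrib) auto
  have "bij_betw (\<lambda>(z, y). y \<otimes> z) ?S (root_set G (a * b))"
  proof (rule bij_betw_byWitness[where f' = "\<lambda>x. (x [^] v, x [^] u)"])
    show "\<forall>p\<in>?S. (\<lambda>x. (x [^] v, x [^] u)) ((\<lambda>(z, y). y \<otimes> z) p) = p"
    proof
      fix p assume "p \<in> ?S"
      then obtain z y where p: "p = (z, y)" and zy: "z \<in> carrier G" "z [^] b = \<one>" "y \<in> carrier G"
        "y \<otimes> z = z \<otimes> y" "y [^] a = \<one>"
        using S by (metis surj_pair)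
      have "y [^] v = \<one>" "z [^] u = \<one>" using zy dv pow1' by auto
      moreover have "z [^] v = z" "y [^] u = y" using zy u v by (auto intro: pow_eq_self)
      ultimately have "(y \<otimes> z) [^] v = z" "(y \<otimes> z) [^] u = y" using zy by (simp_all add: distr)
      thus "(\<lambda>x. (x [^] v, x [^] u)) ((\<lambda>(z, y). y \<otimes> z) p) = p" by (simp add: p)
    qed
    show "\<forall>x\<in>root_set G (a * b). (\<lambda>(z, y). y \<otimes> z) (x [^] v, x [^] u) = x"
    proof
      fix x assume "x \<in> root_set G (a * b)"
      hence x: "x \<in> carrier G" "x [^] (a * b) = \<one>" by (auto simp: root_set_def)
      have "x [^] u \<otimes> x [^] v = x" using x uv pow_eq_self by (simp add: nat_pow_mult)
      thus "(\<lambda>(z, y). y \<otimes> z) (x [^] v, x [^] u) = x" by simp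
    qed
    show "(\<lambda>(z, y). y \<otimes> z) ` ?S \<subseteq> root_set G (a * b)"
    proof (rule image_subsetI)
      fix p assume "p \<in> ?S"
      then obtain z y where p: "p = (z, y)" and zy: "z \<in> carrier G" "z [^] b = \<one>" "y \<in> carrier G"
        "y \<otimes> z = z \<otimes> y" "y [^] a = \<one>"
        using S by (metis surj_pair)
      have "z [^] (a * b) = \<one>" "y [^] (a * b) = \<one>" using zy by (auto intro: pow1' dvd_triv_left dvd_triv_right)
      thus "(\<lambda>(z, y). y \<otimes> z) p \<in> root_set G (a * b)" using zy by (simp add: p root_set_def distr)
    qed
    show "(\<lambda>x. (x [^] v, x [^] u)) ` root_set G (a * b) \<subseteq> ?S"
    proof (rule image_subsetI, unfold S, intro conjI)
      fix x assume "x \<in> root_set G (a * b)"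
      hence x: "x \<in> carrier G" "x [^] (a * b) = \<one>" by (auto simp: root_set_def)
      have *: "a * b dvd v * b" "a * b dvd u * a" using dv by (auto simp: mult.commute[of u] mult_dvd_mono)
      show "(x [^] v) [^] b = \<one>" "(x [^] u) [^] a = \<one>" using pow1'[OF x] * x by (auto simp: nat_pow_pow)
      show "x [^] u \<otimes> x [^] v = x [^] v \<otimes> x [^] u" using x by (simp add: nat_pow_mult add.commute)
    qed (auto simp: root_set_def)
  qed
  from bij_betw_same_card[OF this] have "card (root_set G (a * b)) = card ?S" by simp
  also have "\<dots> = (\<Sum>z\<in>root_set G b. card (root_set (G\<lparr>carrier := centralizer G z\<rparr>) a))"
    using fin by (intro card_SigmaI) (auto simp: root_set_def centralizer_def)
  finally show ?thesis .
qed


section \<open>Element orders, generators of cyclic subgroups, Cauchy's theorem\<close>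

lemma mem_root_set_iff: "x \<in> root_set G d \<longleftrightarrow> x \<in> carrier G \<and> ord x dvd d"
  by (auto simp: root_set_def pow_eq_id)

lemma finite_root_set: "finite (carrier G) \<Longrightarrow> finite (root_set G d)"
  by (simp add: root_set_def)

lemma root_set_gcd_order: "root_set G (gcd d (order G)) = root_set G d"
  by (auto simp: mem_root_set_iff ord_dvd_group_order)

lemma group_centralizer: "z \<in> carrier G \<Longrightarrow> group (G\<lparr>carrier := centralizer G z\<rparr>)"
  by (simp add: subgroup_centralizer subgroup_imp_group)

lemma centralizer_subset: "centralizer G z \<subseteq> carrier G"
  by (auto simp: centralizer_def)

text \<open>An element of a finite cyclic subgroup having full order generates it, by counting. The
  left description is the one that can be counted, the right one is visibly an equivalence
  class.\<close>

lemma mem_generators_iff: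
  assumes fin: "finite (carrier G)" and x: "x \<in> carrier G"
  shows "y \<in> generate G {x} \<and> ord y = ord x \<longleftrightarrow> y \<in> carrier G \<and> generate G {y} = generate G {x}"
proof
  assume y: "y \<in> generate G {x} \<and> ord y = ord x"
  have yc: "y \<in> carrier G" using y x generate_incl[of "{x}"] by auto
  have "generate G {y} \<subseteq> generate G {x}"
    using y x by (intro generate_subgroup_incl) (auto intro: generate_is_subgroup)
  moreover have "card (generate G {y}) = card (generate G {x})"
    using y yc x by (simp add: generate_pow_card[symmetric])
  moreover have "finite (generate G {x})"
    using fin x generate_incl[of "{x}"] by (auto intro: finite_subset)
  ultimately show "y \<in> carrier G \<and> generate G {y} = generate G {x}"
    using yc by (simp add: card_subset_eq)
next
  assume y: "y \<in> carrier G \<and> generate G {y} = generate G {x}"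
  hence "y \<in> generate G {x}" by (metis generate.incl insertI1)
  thus "y \<in> generate G {x} \<and> ord y = ord x" using y x by (simp add: generate_pow_card)
qed

lemma card_generators:
  assumes fin: "finite (carrier G)" and x: "x \<in> carrier G"
  shows "card {y \<in> generate G {x}. ord y = ord x} = totient (ord x)"
proof -
  have pos: "ord x > 0" using ord_ge_1[OF fin x] by simp
  have "bij_betw (\<lambda>k. x [^] k) (totatives (ord x)) {y \<in> generate G {x}. ord y = ord x}"
    unfolding bij_betw_def
  proof
    show "inj_on (\<lambda>k. x [^] k) (totatives (ord x))"
      by (rule inj_on_subset[OF ord_inj'[OF x]]) (auto simp: totatives_def)
    show "(\<lambda>k. x [^] k) ` totatives (ord x) = {y \<in> generate G {x}. ord y = ord x}"
    proof (intro equalityI subsetI)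
      fix y assume "y \<in> (\<lambda>k. x [^] k) ` totatives (ord x)"
      then obtain k where "y = x [^] k" "coprime k (ord x)" by (auto simp: totatives_def)
      thus "y \<in> {y \<in> generate G {x}. ord y = ord x}"
        using pow_ord_eq_ord_iff[OF fin x, of k] by (auto simp: generate_pow_on_finite_carrier[OF fin x])
    next
      fix y assume y: "y \<in> {y \<in> generate G {x}. ord y = ord x}"
      hence "y \<in> {x [^] k | k. k \<in> {0 .. ord x - 1}}"
        unfolding ord_elems[OF fin x, symmetric] by (simp add: generate_pow_on_finite_carrier[OF fin x])
      then obtain k where k: "y = x [^] k" "k \<le> ord x - 1" by auto
      \<comment> \<open>\<open>ord_elems\<close> yields exponents from 0 to
        \<open>ord x - 1\<close>, whereas totatives lie between 1 and \<open>ord x\<close>. The two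
        ranges differ only in the representative of the identity.\<close>
      define l where "l = (if k = 0 then ord x else k)"
      have l: "y = x [^] l" "0 < l" "l \<le> ord x" using k pos x by (auto simp: l_def)
      hence "coprime l (ord x)" using y pow_ord_eq_ord_iff[OF fin x, of l] by auto
      thus "y \<in> (\<lambda>k. x [^] k) ` totatives (ord x)" using l by (auto simp: totatives_def)
    qed
  qed
  from bij_betw_same_card[OF this] show ?thesis by (simp add: totient_def)
qed

text \<open>With every element, \<open>A\<close> contains all generators of the cyclic subgroup that
  it spans. There are \<open>totient (ord x)\<close> of them, a multiple of
  \<open>totient k\<close>.\<close>

lemma totient_dvd_card:
  assumes fin: "finite (carrier G)" and A: "A \<subseteq> carrier G"
    and k: "\<And>x. x \<in> A \<Longrightarrow> k dvd ord x"
    and closed: "\<And>x y. x \<in> A \<Longrightarrow> y \<in> carrier G \<Longrightarrow> ord y = ord x \<Longrightarrow> y \<in> A"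
  shows "totient k dvd card A"
proof -
  define cl where "cl x = {y \<in> generate G {x}. ord y = ord x}" for x
  have cl: "y \<in> cl x \<longleftrightarrow> y \<in> carrier G \<and> generate G {y} = generate G {x}" if "x \<in> carrier G" for x y
    using mem_generators_iff[OF fin that] by (simp add: cl_def)
  have clo: "ord y = ord x" if "y \<in> cl x" for x y
    using that by (simp add: cl_def)
  have "totient k dvd (\<Sum>x\<in>A. 1::nat)"
  proof (rule dvd_sum_over_classes[where cl = cl])
    show "finite A" using fin A finite_subset by blast
    show "x \<in> cl x" if "x \<in> A" for x using that A cl by blast
    show "cl x \<subseteq> A" if "x \<in> A" for x
      using that A cl clo closed by blast
    show "cl y = cl x" if "x \<in> A" "y \<in> cl x" for x y
    proof -
      have "x \<in> carrier G" using that A by auto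
      with cl[of x] cl[of y] that show ?thesis by blast
    qed
    show "totient k dvd card (cl x) * 1" if "x \<in> A" for x
      using that A k card_generators[OF fin, of x] totient_dvd[of k "ord x"] by (auto simp: cl_def)
  qed simp
  thus ?thesis by simp
qed

text \<open>Cauchy's theorem: Sylow's theorem with exponent one supplies a subgroup of order
  \<open>p\<close>, and each of its nontrivial elements has order \<open>p\<close>.\<close>

lemma obtain_ord_eq_prime:
  assumes fin: "finite (carrier G)" and p: "prime p" "p dvd order G"
  obtains x where "x \<in> carrier G" "ord x = p"
proof -
  obtain m where "order G = p ^ 1 * m" using p by auto
  from sylow_thm[OF p(1) group_axioms this fin] obtain H where H: "subgroup H G" "card H = p" by auto
  interpret H: group "G\<lparr>carrier := H\<rparr>" using H(1) by (rule subgroup_imp_group)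
  have "H \<noteq> {\<one>}" using H p prime_gt_1_nat[of p] by auto
  then obtain x where x: "x \<in> H" "x \<noteq> \<one>" using subgroup.one_closed[OF H(1)] by auto
  have xc: "x \<in> carrier G" using x subgroup.subset[OF H(1)] by auto
  have "x [^]\<^bsub>G\<lparr>carrier := H\<rparr>\<^esub> p = \<one>" using H.pow_order_eq_1[of x] x H(2) by (simp add: order_def)
  hence "x [^] p = \<one>" by (simp add: nat_pow_consistent[symmetric])
  hence "ord x dvd p" using pow_eq_id[OF xc] by simp
  moreover have "ord x \<noteq> 1" using x ord_eq_1[OF xc] by simp
  ultimately have "ord x = p" using p(1) by (auto simp: prime_nat_iff)
  with xc show ?thesis using that by blast
qed

lemma order_centralizer_dvd: "z \<in> carrier G \<Longrightarrow> card (centralizer G z) dvd order G"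
  by (metis card_conj_class dvd_triv_right)

text \<open>Central solutions commute, so they form a subgroup. If \<open>p\<close> divided its
  order, Cauchy's theorem would give an element of order \<open>p\<close> among the solutions of
  \<open>y^m = 1\<close>, and \<open>p\<close> would divide \<open>m\<close>.\<close>

lemma not_dvd_card_central_root_set:
  assumes fin: "finite (carrier G)" and p: "prime p" and pm: "\<not> p dvd m"
  shows "\<not> p dvd card {z \<in> root_set G m. centralizer G z = carrier G}"
proof
  let ?Z = "{z \<in> root_set G m. centralizer G z = carrier G}"
  assume pZ: "p dvd card ?Z"
  have "?Z = {z \<in> carrier G. z [^] m = \<one> \<and> (\<forall>g\<in>carrier G. g \<otimes> z = z \<otimes> g)}"
    by (auto simp: root_set_def centralizer_def)
  moreover have "subgroup \<dots> G"
  proof (rule subgroupI)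
    show "{z \<in> carrier G. z [^] m = \<one> \<and> (\<forall>g\<in>carrier G. g \<otimes> z = z \<otimes> g)} \<noteq> {}" by force
  next
    fix a assume a: "a \<in> {z \<in> carrier G. z [^] m = \<one> \<and> (\<forall>g\<in>carrier G. g \<otimes> z = z \<otimes> g)}"
    have "g \<otimes> inv a = inv a \<otimes> g" if "g \<in> carrier G" for g
    proof -
      have "inv g \<otimes> a = a \<otimes> inv g" using a that by simp
      hence "inv (inv g \<otimes> a) = inv (a \<otimes> inv g)" by (rule arg_cong)
      moreover have "inv (inv g \<otimes> a) = inv a \<otimes> g" using a that inv_mult_group[of "inv g" a] by simp
      moreover have "inv (a \<otimes> inv g) = g \<otimes> inv a" using a that inv_mult_group[of a "inv g"] by simp
      ultimately show ?thesis by simp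
    qed
    thus "inv a \<in> {z \<in> carrier G. z [^] m = \<one> \<and> (\<forall>g\<in>carrier G. g \<otimes> z = z \<otimes> g)}"
      using a by (simp add: nat_pow_inv)
  next
    fix a b assume ab: "a \<in> {z \<in> carrier G. z [^] m = \<one> \<and> (\<forall>g\<in>carrier G. g \<otimes> z = z \<otimes> g)}"
      "b \<in> {z \<in> carrier G. z [^] m = \<one> \<and> (\<forall>g\<in>carrier G. g \<otimes> z = z \<otimes> g)}"
    have c: "a \<in> carrier G" "b \<in> carrier G" "a [^] m = \<one>" "b [^] m = \<one>" using ab by simp_all
    have g: "g \<otimes> (a \<otimes> b) = a \<otimes> b \<otimes> g" if "g \<in> carrier G" for g
    proof -
      have ga: "g \<otimes> a = a \<otimes> g" and gb: "g \<otimes> b = b \<otimes> g" using ab that by blast+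
      have "g \<otimes> (a \<otimes> b) = (g \<otimes> a) \<otimes> b" using c that by (simp add: m_assoc)
      also have "\<dots> = a \<otimes> (g \<otimes> b)" using c that by (simp add: ga m_assoc)
      also have "\<dots> = a \<otimes> b \<otimes> g" using c that by (simp add: gb m_assoc)
      finally show ?thesis .
    qed
    have "a \<otimes> b = b \<otimes> a" using ab by blast
    hence "(a \<otimes> b) [^] m = \<one>" using c by (simp add: pow_mult_distrib)
    thus "a \<otimes> b \<in> {z \<in> carrier G. z [^] m = \<one> \<and> (\<forall>g\<in>carrier G. g \<otimes> z = z \<otimes> g)}"
      using c g by blast
  qed auto
  ultimately have sZ: "subgroup ?Z G" by simp
  interpret Z: group "G\<lparr>carrier := ?Z\<rparr>" using sZ by (rule subgroup_imp_group)
  obtain y where y: "y \<in> ?Z" "Z.ord y = p"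
    using Z.obtain_ord_eq_prime[of p] p pZ fin by (auto simp: order_def finite_root_set)
  have "y [^] m = \<one>" using y by (simp add: root_set_def)
  hence "p dvd m" using Z.pow_eq_id[of y m] y by (simp add: nat_pow_consistent[symmetric])
  thus False using pm by simp
qed

end

text \<open>Count G by the prime-to-p parts z of its elements. Induction on the centralizers handles the
  noncentral z, and the number of central z is prime to p.\<close>

lemma card_root_set_full_prime_power:
  fixes G :: "('a, 'b) monoid_scheme"
  assumes "group G" "finite (carrier G)" "prime p" "multiplicity p (order G) \<le> e"
  shows "p ^ multiplicity p (order G) dvd card (root_set G (p ^ e))"
  using assms
proof (induction "order G" arbitrary: G e rule: less_induct)
  case less
  interpret group G by fact
  note fin = \<open>finite (carrier G)\<close> and p = \<open>prime p\<close>
  have n0: "order G \<noteq> 0" using fin order_gt_0_iff_finite by simp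
  define k where "k = multiplicity p (order G)"
  define m where "m = order G div p ^ k"
  have n: "order G = p ^ k * m" unfolding m_def k_def by (simp add: multiplicity_dvd)
  have pm: "\<not> p dvd m" unfolding m_def k_def
    using n0 p multiplicity_decompose by (metis not_prime_unit)
  have cop: "coprime (p ^ e) m" using p pm by (simp add: prime_imp_coprime)
  have m0: "m > 0" using n n0 by (cases m) auto
  have pe0: "p ^ e > 0" using p prime_gt_0_nat by simp
  define c where "c z = card (root_set (G\<lparr>carrier := centralizer G z\<rparr>) (p ^ e))" for z
  define Z where "Z = {z \<in> root_set G m. centralizer G z = carrier G}"
  define N where "N = {z \<in> root_set G m. centralizer G z \<noteq> carrier G}"
  \<comment> \<open>The exponent \<open>p ^ e\<close> stays fixed when the induction passes to a
    centralizer, whose \<open>p\<close>-part may be smaller; hence \<open>k \<le> e\<close> instead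
    of equality. It suffices for every element to solve the equation.\<close>
  have RU: "root_set G (p ^ e * m) = carrier G"
  proof -
    have "k \<le> e" using less.prems k_def by simp
    hence "order G dvd p ^ e * m" unfolding n by (simp add: le_imp_power_dvd)
    thus ?thesis using ord_dvd_group_order dvd_trans by (auto simp: mem_root_set_iff)
  qed
  have "order G = sum c (root_set G m)"
    using card_root_set_mult[OF fin cop pe0 m0] by (simp add: RU c_def order_def)
  also have "\<dots> = sum c Z + sum c N"
    by (subst sum.union_disjoint[symmetric]) (auto simp: Z_def N_def finite_root_set fin intro!: sum.cong)
  \<comment> \<open>For central \<open>z\<close> the centralizer is the whole group, so each summand
    is the number under investigation.\<close>
  also have "sum c Z = card Z * card (root_set G (p ^ e))"
    by (simp add: Z_def c_def)
  finally have main: "order G = card Z * card (root_set G (p ^ e)) + sum c N" .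
  have "p ^ k dvd sum c N"
  proof (rule dvd_sum_conj_classes)
    show "finite N" by (simp add: N_def finite_root_set fin)
    show "N \<subseteq> carrier G" by (auto simp: N_def root_set_def)
    show "c y = c x" if "x \<in> N" "y \<in> conj_class G x" for x y
      using that card_root_set_centralizer_conj by (simp add: N_def c_def root_set_def)
  next
    fix x assume x: "x \<in> N"
    hence xc: "x \<in> carrier G" by (simp add: N_def root_set_def)
    show "conj_class G x \<subseteq> N"
    proof
      fix y assume y: "y \<in> conj_class G x"
      hence yc: "y \<in> carrier G" using xc by (auto simp: conj_class_def)
      have "card (centralizer G y) = card (centralizer G x)"
        using card_conj_class[OF xc] card_conj_class[OF yc] conj_class_eq[OF xc y] n0
        by (metis mult_cancel1 mult_eq_0_iff)
      moreover have "card (centralizer G x) < order G"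
        unfolding order_def using x fin by (intro psubset_card_mono) (auto simp: N_def centralizer_def)
      ultimately have "centralizer G y \<noteq> carrier G" by (auto simp: order_def)
      thus "y \<in> N" using y x conj_class_root_set by (auto simp: N_def)
    qed
    let ?C = "G\<lparr>carrier := centralizer G x\<rparr>"
    have oC: "order ?C = card (centralizer G x)" by (simp add: order_def)
    have "order ?C < order G" unfolding oC
      unfolding order_def using x fin by (intro psubset_card_mono) (auto simp: N_def centralizer_def)
    moreover have "multiplicity p (order ?C) \<le> e"
      using less.prems(4) n0 order_centralizer_dvd[OF xc] oC by (metis dvd_imp_multiplicity_le le_trans)
    ultimately have *: "p ^ multiplicity p (order ?C) dvd c x"
      unfolding c_def using xc fin p finite_subset[OF centralizer_subset]
      by (intro less.hyps) (auto simp: group_centralizer)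
    \<comment> \<open>The class length supplies exactly those factors \<open>p\<close> of the group
      order that the order of the centralizer lacks.\<close>
    have cc: "order G = card (conj_class G x) * order ?C" using card_conj_class[OF xc] oC by simp
    hence "k = multiplicity p (card (conj_class G x)) + multiplicity p (order ?C)"
      using n0 p unfolding k_def cc by (subst prime_elem_multiplicity_mult_distrib) auto
    thus "p ^ k dvd card (conj_class G x) * c x"
      using * by (simp add: power_add mult_dvd_mono multiplicity_dvd)
  qed
  hence "p ^ k dvd card Z * card (root_set G (p ^ e))"
    using main n by (metis dvd_add_left_iff dvd_triv_left)
  moreover have "\<not> p dvd card Z" unfolding Z_def using fin p pm by (rule not_dvd_card_central_root_set)
  ultimately have "p ^ k dvd card (root_set G (p ^ e))"
    using p by (metis coprime_dvd_mult_right_iff coprime_power_left_iff prime_imp_coprime)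
  thus ?case by (simp add: k_def)
qed

section \<open>Frobenius' theorem, for prime powers and for all divisors\<close>

context group
begin

text \<open>Downward induction from the full power of \<open>p\<close>. Passing from exponent
  \<open>p ^ b\<close> to \<open>p ^ Suc b\<close> adds exactly the elements of order
  \<open>p ^ Suc b\<close>, and their number is divisible by the totient
  \<open>p ^ b * (p - 1)\<close>.\<close>

lemma dvd_card_root_set_prime_power:
  assumes fin: "finite (carrier G)" and p: "prime p" and dvd: "p ^ b dvd order G"
  shows "p ^ b dvd card (root_set G (p ^ b))"
proof -
  have n0: "order G \<noteq> 0" using fin order_gt_0_iff_finite by simp
  have "b \<le> multiplicity p (order G)"
    using dvd n0 p by (metis multiplicity_geI not_prime_unit)
  thus ?thesis
  proof (induction rule: inc_induct)
    case base
    show ?case using card_root_set_full_prime_power[OF group_axioms fin p] by simp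
  next
    case (step b)
    let ?A = "root_set G (p ^ Suc b) - root_set G (p ^ b)"
    have sub: "root_set G (p ^ b) \<subseteq> root_set G (p ^ Suc b)" by (auto simp: mem_root_set_iff)
    have "totient (p ^ Suc b) dvd card ?A"
    proof (rule totient_dvd_card[OF fin])
      fix x assume "x \<in> ?A"
      hence x: "ord x dvd p ^ Suc b" "\<not> ord x dvd p ^ b" by (auto simp: mem_root_set_iff)
      then obtain i where i: "i \<le> Suc b" "ord x = p ^ i" using divides_primepow_nat[OF p] by blast
      hence "i = Suc b" using x(2) by (metis le_SucE le_imp_power_dvd)
      thus "p ^ Suc b dvd ord x" using i by simp
    qed (auto simp: mem_root_set_iff)
    moreover have "totient (p ^ Suc b) = p ^ b * (p - 1)" by (rule totient_prime_power_Suc[OF p])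
    ultimately have "p ^ b dvd card ?A" using dvd_mult_left by metis
    moreover have "p ^ b dvd card (root_set G (p ^ Suc b))" using step.IH unfolding power_Suc by (rule dvd_mult_right)
    moreover have "card (root_set G (p ^ Suc b)) = card ?A + card (root_set G (p ^ b))"
      using sub by (metis card_Diff_subset card_mono fin finite_root_set finite_subset le_add_diff_inverse2)
    ultimately show ?case by (metis dvd_add_right_iff)
  qed
qed

text \<open>Frobenius' theorem, checked one prime at a time. For \<open>d = p ^ b * s\<close> with
  \<open>s\<close> prime to \<open>p\<close>, the solutions are counted by their factors
  \<open>z\<close> with \<open>z^s = 1\<close>; the conjugacy class of \<open>z\<close> contributes
  its length times a count of solutions in the centralizer of \<open>z\<close>, to which the prime
  power case applies.\<close>

theorem dvd_card_root_set:
  assumes fin: "finite (carrier G)" and d: "d dvd order G"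
  shows "d dvd card (root_set G d)"
proof -
  have n0: "order G \<noteq> 0" using fin order_gt_0_iff_finite by simp
  hence d0: "d \<noteq> 0" using d by auto
  have "\<one> \<in> root_set G d" by (simp add: root_set_def)
  hence f0: "card (root_set G d) \<noteq> 0" using finite_root_set[OF fin] by auto
  have "multiplicity p d \<le> multiplicity p (card (root_set G d))" if p: "prime p" for p
  proof (rule multiplicity_geI)
    show "\<not> is_unit p" using p by auto
    define b where "b = multiplicity p d"
    define s where "s = d div p ^ b"
    have ds: "d = p ^ b * s" unfolding s_def b_def by (simp add: multiplicity_dvd)
    have "\<not> p dvd s" unfolding s_def b_def
      using d0 p multiplicity_decompose by (metis not_prime_unit)
    hence cop: "coprime (p ^ b) s" using p by (simp add: prime_imp_coprime)
    have s0: "s > 0" using ds d0 by (cases s) auto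
    have pb: "p ^ b dvd order G" using ds d dvd_mult_left by blast
    have "p ^ b dvd (\<Sum>z\<in>root_set G s. card (root_set (G\<lparr>carrier := centralizer G z\<rparr>) (p ^ b)))"
    proof (rule dvd_sum_conj_classes)
      fix x assume x: "x \<in> root_set G s"
      show "conj_class G x \<subseteq> root_set G s" using conj_class_root_set[OF x] .
      have xc: "x \<in> carrier G" using x by (simp add: root_set_def)
      interpret C: group "G\<lparr>carrier := centralizer G x\<rparr>" using group_centralizer[OF xc] .
      let ?C = "G\<lparr>carrier := centralizer G x\<rparr>"
      have finC: "finite (carrier ?C)" using fin finite_subset[OF centralizer_subset] by simp
      \<comment> \<open>\<open>p ^ b\<close> need not divide the order of the centralizer. The
        equation has the same solutions there as with the gcd for exponent, which is a power of
        \<open>p\<close> that does divide it.\<close>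
      obtain c where c: "gcd (p ^ b) (order ?C) = p ^ c"
        using divides_primepow_nat[OF p] by (metis gcd_dvd1)
      have "p ^ c dvd card (root_set ?C (p ^ c))"
        using C.dvd_card_root_set_prime_power[OF finC p] c by (metis gcd_dvd2)
      hence "gcd (p ^ b) (order ?C) dvd card (root_set ?C (p ^ b))"
        using C.root_set_gcd_order c by metis
      hence "card (conj_class G x) * gcd (p ^ b) (order ?C) dvd card (conj_class G x) * card (root_set ?C (p ^ b))"
        by simp
      \<comment> \<open>The right side is the gcd of \<open>card (conj_class G x) * p ^ b\<close>
        and the order of \<open>G\<close>, and \<open>p ^ b\<close> divides both.\<close>
      moreover have "p ^ b dvd card (conj_class G x) * gcd (p ^ b) (order ?C)"
        using pb card_conj_class[OF xc] by (simp add: gcd_mult_distrib_nat order_def)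
      ultimately show "p ^ b dvd card (conj_class G x) * card (root_set ?C (p ^ b))"
        using dvd_trans by blast
    next
      show "card (root_set (G\<lparr>carrier := centralizer G y\<rparr>) (p ^ b)) =
            card (root_set (G\<lparr>carrier := centralizer G x\<rparr>) (p ^ b))"
        if "x \<in> root_set G s" "y \<in> conj_class G x" for x y
        using that by (intro card_root_set_centralizer_conj) (auto simp: root_set_def)
    qed (use fin in \<open>auto simp: root_set_def\<close>)
    also have "\<dots> = card (root_set G d)"
      unfolding ds using p by (intro card_root_set_mult[symmetric] fin cop s0) (simp add: prime_gt_0_nat)
    finally show "p ^ multiplicity p d dvd card (root_set G d)" by (simp add: b_def)
  qed (fact f0)
  thus ?thesis using d0 f0 by (metis multiplicity_le_imp_dvd)
qed

end

section \<open>Numbers of divisors and units modulo n\<close>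

lemma common_prime_factor_nat:
  fixes a b :: nat
  assumes "\<not> coprime a b"
  obtains p where "prime p" "p dvd a" "p dvd b"
proof -
  obtain p where "prime p" "p dvd gcd a b"
    using assms prime_factor_nat[of "gcd a b"] coprime_iff_gcd_eq_1 by blast
  thus ?thesis using that by auto
qed

lemma card_divisors_prime_power_mult:
  fixes p m :: nat
  assumes p: "prime p" and pm: "\<not> p dvd m" and m: "m > 0"
  shows "card {d. d dvd p ^ e * m} = Suc e * card {d. d dvd m}"
proof -
  have "bij_betw (\<lambda>(i, d). p ^ i * d) ({..e} \<times> {d. d dvd m}) {d. d dvd p ^ e * m}"
    unfolding bij_betw_def
  proof
    show "inj_on (\<lambda>(i, d). p ^ i * d) ({..e} \<times> {d. d dvd m})"
    proof (rule inj_onI, clarify)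
      fix i d j d' assume *: "d dvd m" "d' dvd m" "p ^ i * d = p ^ j * d'"
      have nd: "\<not> p dvd d" "\<not> p dvd d'" using * pm dvd_trans by blast+
      have "i = j" using prime_power_cancel[OF p, of d i d' j] nd *(3) by (simp add: mult.commute)
      thus "i = j \<and> d = d'" using *(3) p by simp
    qed
    show "(\<lambda>(i, d). p ^ i * d) ` ({..e} \<times> {d. d dvd m}) = {d. d dvd p ^ e * m}"
    proof (intro equalityI subsetI)
      fix x assume "x \<in> {d. d dvd p ^ e * m}"
      then obtain b c where bc: "x = b * c" "b dvd p ^ e" "c dvd m" using division_decomp by blast
      then obtain i where "i \<le> e" "b = p ^ i" using divides_primepow_nat[OF p] by blast
      thus "x \<in> (\<lambda>(i, d). p ^ i * d) ` ({..e} \<times> {d. d dvd m})" using bc by force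
    qed (auto intro: mult_dvd_mono le_imp_power_dvd)
  qed
  from bij_betw_same_card[OF this] show ?thesis by (simp add: card_cartesian_product)
qed

lemma prime_power_decompose_nat:
  fixes n p :: nat
  assumes "prime p" "n > 0"
  obtains m where "n = p ^ multiplicity p n * m" "\<not> p dvd m" "m > 0"
proof -
  obtain m where m: "n = p ^ multiplicity p n * m" "\<not> p dvd m"
    using multiplicity_decompose'[of n p] assms by (metis not_prime_unit neq0_conv)
  moreover have "m > 0" using m by (cases m) auto
  ultimately show ?thesis using that by blast
qed

lemma card_prime_factors_prime_power_mult:
  fixes p m :: nat
  assumes p: "prime p" and pm: "\<not> p dvd m" and m: "m > 0" and e: "e > 0"
  shows "card (prime_factors (p ^ e * m)) = Suc (card (prime_factors m))"
proof -
  have "prime_factors (p ^ e * m) = insert p (prime_factors m)"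
    using assms by (auto simp: prime_factors_dvd prime_dvd_mult_iff prime_dvd_power_iff primes_dvd_imp_eq)
  moreover have "p \<notin> prime_factors m" using pm by auto
  ultimately show ?thesis by simp
qed

lemma card_divisors_ge:
  fixes n :: nat
  assumes "n > 0"
  shows "2 ^ card (prime_factors n) \<le> card {d. d dvd n}"
  using assms
proof (induction n rule: less_induct)
  case (less n)
  show ?case
  proof (cases "n = 1")
    case False
    then obtain p where p: "prime p" "p dvd n" using prime_factor_nat by blast
    obtain m where m: "n = p ^ multiplicity p n * m" "\<not> p dvd m" "m > 0"
      using prime_power_decompose_nat[OF p(1) less.prems] .
    define e where "e = multiplicity p n"
    have e: "e > 0" using p less.prems by (simp add: e_def prime_multiplicity_gt_zero_iff)
    have ne: "n = p ^ e * m" using m(1) by (simp add: e_def)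
    have "p ^ e > 1" using p e prime_gt_1_nat[OF p(1)] one_less_power by blast
    hence "m < n" using ne m(3) by simp
    hence "2 ^ card (prime_factors m) \<le> card {d. d dvd m}" using less.IH m(3) by blast
    hence "2 * 2 ^ card (prime_factors m) \<le> Suc e * card {d. d dvd m}" using e by (intro mult_mono) auto
    thus ?thesis unfolding ne
      using card_divisors_prime_power_mult[OF p(1) m(2,3)]
        card_prime_factors_prime_power_mult[OF p(1) m(2,3) e] by simp
  qed simp
qed

lemma card_divisors_squarefree:
  fixes n :: nat
  assumes "squarefree n"
  shows "card {d. d dvd n} = 2 ^ card (prime_factors n)"
  using assms
proof (induction n rule: less_induct)
  case (less n)
  have n0: "n > 0" using less.prems by (cases n) auto
  show ?case
  proof (cases "n = 1")
    case False
    then obtain p where p: "prime p" "p dvd n" using prime_factor_nat by blast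
    then obtain m where m: "n = p ^ 1 * m" by auto
    have pm: "\<not> p dvd m"
    proof
      assume "p dvd m"
      hence "p\<^sup>2 dvd n" using m by (auto simp: power2_eq_square)
      thus False using squarefreeD[OF less.prems] p(1) not_prime_unit by blast
    qed
    have m0: "m > 0" using m n0 by (cases m) auto
    have "m < n" using m m0 prime_gt_1_nat[OF p(1)] by simp
    moreover have "squarefree m" using less.prems m squarefree_mono by (metis dvd_triv_right)
    ultimately have "card {d. d dvd m} = 2 ^ card (prime_factors m)" using less.IH by blast
    thus ?thesis
      using card_divisors_prime_power_mult[OF p(1) pm m0, of 1]
        card_prime_factors_prime_power_mult[OF p(1) pm m0, of 1] m by simp
  qed simp
qed

text \<open>A prime with exponent at least 2 contributes a factor at least 3 to the number of
  divisors, every other prime a factor at least 2.\<close>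

lemma card_divisors_not_squarefree:
  fixes n :: nat
  assumes n: "n > 0" and "\<not> squarefree n"
  shows "3 * 2 ^ card (prime_factors n) \<le> 2 * card {d. d dvd n}"
proof -
  obtain x where x: "x\<^sup>2 dvd n" "x \<noteq> 1"
    using assms(2) by (auto elim: not_squarefreeE)
  obtain p where p: "prime p" "p dvd x" using x prime_factor_nat by blast
  have "p\<^sup>2 dvd n" using p(2) x(1) dvd_power_same dvd_trans by blast
  hence e: "2 \<le> multiplicity p n" using n p(1) by (intro multiplicity_geI) auto
  obtain m where m: "n = p ^ multiplicity p n * m" "\<not> p dvd m" "m > 0"
    using prime_power_decompose_nat[OF p(1) n] .
  define e where "e = multiplicity p n"
  have ne: "n = p ^ e * m" and e2: "2 \<le> e" using m(1) e by (simp_all add: e_def)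
  have "3 * 2 ^ card (prime_factors m) \<le> Suc e * card {d. d dvd m}"
    using e2 card_divisors_ge[OF m(3)] by (intro mult_mono) auto
  thus ?thesis unfolding ne
    using card_divisors_prime_power_mult[OF p(1) m(2,3)] e2
      card_prime_factors_prime_power_mult[OF p(1) m(2,3), of e] by simp
qed

text \<open>Representatives below \<open>n\<close>, unlike \<open>totatives\<close>, which lie
  between 1 and \<open>n\<close>: reduction with \<open>mod n\<close> stays inside the set. For
  \<open>n = 1\<close> the only unit is 0.\<close>

definition unit_residues :: "nat \<Rightarrow> nat set" where
  "unit_residues n = {k. k < n \<and> coprime k n}"

lemma finite_unit_residues [simp]: "finite (unit_residues n)"
  by (simp add: unit_residues_def)

lemma card_unit_residues: 
  assumes "n > 0" shows "card (unit_residues n) = totient n"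
proof (cases "n = 1")
  case True
  have "unit_residues 1 = {0}" by (auto simp: unit_residues_def)
  with True show ?thesis by simp
next
  case False
  have "unit_residues n = totatives n" 
    using False assms by (auto simp: unit_residues_def totatives_def intro!: Nat.gr0I le_neq_implies_less)
  thus ?thesis by (simp add: totient_def)
qed

text \<open>When \<open>d\<close> divides \<open>n\<close>, this is the surjectivity of the
  reduction from units modulo \<open>n\<close> to units modulo \<open>d\<close>.\<close>

lemma coprime_lift_nat:
  fixes r d n :: nat
  assumes "coprime r d" "n > 0"
  obtains s where "coprime s n" "[s = r] (mod d)"
proof
  \<comment> \<open>A prime of \<open>n\<close> dividing \<open>r\<close> divides neither
    \<open>d\<close> nor \<open>t\<close>; a prime of \<open>n\<close> not dividing \<open>r\<close>
    divides \<open>t\<close>. Either way it does not divide \<open>r + d * t\<close>.\<close>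
  define t where "t = \<Prod>{p \<in> prime_factors n. \<not> p dvd r}"
  show "[r + d * t = r] (mod d)" by (simp add: cong_def)
  show "coprime (r + d * t) n"
  proof (rule ccontr)
    assume "\<not> coprime (r + d * t) n"
    then obtain p where p: "prime p" "p dvd r + d * t" "p dvd n"
      using common_prime_factor_nat by blast
    show False
    proof (cases "p dvd r")
      case True
      hence "p dvd d * t" using p(2) by (simp add: dvd_add_right_iff)
      moreover have "\<not> p dvd d" using True assms(1) p(1) by (metis coprime_common_divisor_nat not_prime_1)
      ultimately have "p dvd t" using p(1) prime_dvd_mult_iff by blast
      then obtain q where "q \<in> prime_factors n" "\<not> q dvd r" "p dvd q"
        unfolding t_def using p(1) by (subst (asm) prime_dvd_prod_iff) auto
      thus False using True p(1) primes_dvd_imp_eq by (metis in_prime_factors_imp_prime)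
    next
      case False
      hence "p \<in> {p \<in> prime_factors n. \<not> p dvd r}" using p assms by (simp add: prime_factors_dvd)
      hence "p dvd t" unfolding t_def by (intro dvd_prodI) auto
      hence "p dvd r" using p(2) by (metis dvd_add_left_iff dvd_mult)
      thus False using False by simp
    qed
  qed
qed

text \<open>The set counted is the kernel of the reduction from units modulo \<open>n\<close> to
  units modulo \<open>d\<close>. The fibres \<open>F r\<close> partition the units modulo
  \<open>n\<close>, and multiplication by a lift \<open>s\<close> of \<open>r\<close> carries the
  kernel onto the fibre of \<open>r\<close>.\<close>

lemma card_unit_residues_cong_1:
  fixes d n :: nat
  assumes d: "d dvd n" and n: "n > 0"
  shows "card {k \<in> unit_residues n. [k = 1] (mod d)} * totient d = totient n"
proof -
  have d0: "d > 0" using d n by (rule dvd_pos_nat[rotated])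
  define F where "F r = {k \<in> unit_residues n. [k = r] (mod d)}" for r
  have cardF: "card (F r) = card (F 1)" if r: "r \<in> unit_residues d" for r
  proof -
    have "coprime r d" using r by (simp add: unit_residues_def)
    then obtain s where s: "coprime s n" "[s = r] (mod d)" using coprime_lift_nat n by blast
    obtain t where t: "[s * t = 1] (mod n)" using cong_solve_coprime_nat[OF s(1)] by auto
    have "coprime (s * t) n" using cong_imp_coprime[OF cong_sym[OF t]] by simp
    hence tn: "coprime t n" by simp
    have td: "[s * t = 1] (mod d)" using cong_dvd_modulus_nat[OF t d] .
    have modF: "x mod n \<in> F a" if "coprime x n" "[x = a] (mod d)" for x a
      using that n d by (auto simp: F_def unit_residues_def cong_def mod_mod_cancel)
    have undo: "(k * x mod n) * y mod n = k" if "[x * y = 1] (mod n)" "k < n" for k x y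
    proof -
      have "[(k * x mod n) * y = k * (x * y)] (mod n)" by (simp add: cong_def mod_mult_left_eq mult.assoc)
      also have "[k * (x * y) = k * 1] (mod n)" using that by (intro cong_mult) auto
      finally show ?thesis using that(2) by (simp add: cong_def)
    qed
    have "bij_betw (\<lambda>k. k * s mod n) (F 1) (F r)"
    proof (rule bij_betw_byWitness[where f' = "\<lambda>k. k * t mod n"])
      show "\<forall>k\<in>F 1. (k * s mod n) * t mod n = k" using undo t by (simp add: F_def unit_residues_def)
      show "\<forall>k\<in>F r. (k * t mod n) * s mod n = k" using undo[of t s] t by (simp add: F_def unit_residues_def mult.commute[of t s])
      show "(\<lambda>k. k * s mod n) ` F 1 \<subseteq> F r"
      proof (rule image_subsetI, rule modF)
        fix k assume k: "k \<in> F 1"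
        thus "coprime (k * s) n" using s by (simp add: F_def unit_residues_def)
        have "[k * s = 1 * r] (mod d)" using k s by (intro cong_mult) (auto simp: F_def)
        thus "[k * s = r] (mod d)" by simp
      qed
      show "(\<lambda>k. k * t mod n) ` F r \<subseteq> F 1"
      proof (rule image_subsetI, rule modF)
        fix k assume k: "k \<in> F r"
        thus "coprime (k * t) n" using tn by (simp add: F_def unit_residues_def)
        have "[k = s] (mod d)" using k s by (auto simp: F_def intro: cong_trans cong_sym)
        hence "[k * t = s * t] (mod d)" by (intro cong_mult) auto
        thus "[k * t = 1] (mod d)" using td cong_trans by blast
      qed
    qed
    thus ?thesis using bij_betw_same_card by force
  qed
  have "unit_residues n = (\<Union>r\<in>unit_residues d. F r)"
  proof (intro equalityI subsetI)
    fix k assume k: "k \<in> unit_residues n"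
    hence "coprime k d" using d coprime_divisors[of k k d n] by (simp add: unit_residues_def)
    hence "k mod d \<in> unit_residues d" using d0 by (simp add: unit_residues_def)
    moreover have "k \<in> F (k mod d)" using k by (simp add: F_def cong_def)
    ultimately show "k \<in> (\<Union>r\<in>unit_residues d. F r)" by blast
  qed (auto simp: F_def)
  hence "totient n = card (\<Union>r\<in>unit_residues d. F r)" using card_unit_residues[OF n] by simp
  also have "\<dots> = (\<Sum>r\<in>unit_residues d. card (F r))"
  proof (rule card_UN_disjoint)
    show "\<forall>i\<in>unit_residues d. \<forall>j\<in>unit_residues d. i \<noteq> j \<longrightarrow> F i \<inter> F j = {}"
    proof (intro ballI impI)
      fix i j assume ij: "i \<in> unit_residues d" "j \<in> unit_residues d" "i \<noteq> j"
      have "i = j" if "k \<in> F i" "k \<in> F j" for k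
        using that ij by (simp add: F_def cong_def unit_residues_def)
      thus "F i \<inter> F j = {}" using ij by blast
    qed
  qed (auto simp: F_def)
  also have "\<dots> = totient d * card (F 1)" using cardF card_unit_residues[OF d0] by simp
  finally show ?thesis by (simp add: F_def mult.commute)
qed

text \<open>Modulo \<open>n\<close>, \<open>k + (n - 1)\<close> is \<open>k - 1\<close> without
  truncated subtraction, which matters for the unit \<open>k = 0\<close> when
  \<open>n = 1\<close>.\<close>

lemma cong_1_iff_dvd:
  fixes k d n :: nat
  assumes "d dvd n" "n > 0"
  shows "[k = 1] (mod d) \<longleftrightarrow> d dvd k + (n - 1)"
proof -
  have "[k = 1] (mod d) \<longleftrightarrow> [k + (n - 1) = 1 + (n - 1)] (mod d)" by (simp only: cong_add_rcancel_nat)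
  also have "\<dots> \<longleftrightarrow> [k + (n - 1) = 0] (mod d)" using assms by (auto simp: cong_def)
  finally show ?thesis by (simp add: cong_0_iff)
qed

section \<open>Richards' theorem\<close>

text \<open>Richards' argument: compare the number of fixed points of the power maps by units modulo n,
  which permute the generators of every cyclic subgroup transitively, with the same count in the
  cyclic group of order n.\<close>

theorem (in group) card_divisors_le_num_subgroups:
  assumes fin: "finite (carrier G)"
  shows "card {d. d dvd order G} \<le> num_subgroups G"
proof -
  define n where "n = order G"
  have n: "n > 0" using fin order_gt_0_iff_finite by (simp add: n_def)
  define U where "U = unit_residues n"
  \<comment> \<open>The number of power maps by units that fix an element of order
    \<open>d\<close>.\<close>
  define w where "w d = card {k \<in> U. [k = 1] (mod d)}" for d
  have w: "w d * totient d = totient n" if "d dvd n" for d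
    using card_unit_residues_cong_1[OF that n] by (simp add: w_def U_def)
  \<comment> \<open>The \<open>k\<close>-th power map fixes \<open>x\<close> exactly if the order of
    \<open>x\<close> divides \<open>k - 1\<close>, and also \<open>n\<close>. So its fixed points
    are the solutions of \<open>x^(e k) = 1\<close>.\<close>
  define e where "e k = gcd (k + (n - 1)) n" for k
  have e: "[k = 1] (mod d) \<longleftrightarrow> d dvd e k" if "d dvd n" for k d
    using cong_1_iff_dvd[OF that n] that by (simp add: e_def)
  have finU: "finite U" by (simp add: U_def)
  have finD: "finite {d. d dvd n}" using n by simp
  define cyc where "cyc = (\<lambda>x. generate G {x}) ` carrier G"
  have on: "ord x dvd n" if "x \<in> carrier G" for x
    using ord_dvd_group_order[OF that] by (simp add: n_def)
  \<comment> \<open>The cyclic group of order \<open>n\<close> has \<open>totient d\<close> elements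
    of order \<open>d\<close>, each fixed by \<open>w d\<close> maps; the right side is the total
    number of fixed points there.\<close>
  have "card {d. d dvd n} * totient n = (\<Sum>d\<in>{d. d dvd n}. w d * totient d)"
    using w by simp
  also have "\<dots> = (\<Sum>d\<in>{d. d dvd n}. \<Sum>k\<in>U. if [k = 1] (mod d) then totient d else 0)"
    using finU by (simp add: w_def sum.If_cases Int_def)
  also have "\<dots> = (\<Sum>k\<in>U. \<Sum>d\<in>{d. d dvd n}. if [k = 1] (mod d) then totient d else 0)"
    by (rule sum.swap)
  also have "\<dots> = (\<Sum>k\<in>U. e k)"
  proof (rule sum.cong[OF refl])
    fix k
    have "(\<Sum>d\<in>{d. d dvd n}. if [k = 1] (mod d) then totient d else 0) =
        (\<Sum>d\<in>{d \<in> {d. d dvd n}. [k = 1] (mod d)}. totient d)"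
      using finD by (rule sum.inter_filter[symmetric])
    also have "{d \<in> {d. d dvd n}. [k = 1] (mod d)} = {d. d dvd e k}"
      using e by (auto simp: e_def)
    also have "(\<Sum>d\<in>{d. d dvd e k}. totient d) = e k" by (rule totient_divisor_sum)
    finally show "(\<Sum>d\<in>{d. d dvd n}. if [k = 1] (mod d) then totient d else 0) = e k" .
  qed
  \<comment> \<open>Frobenius' theorem enters here: the \<open>k\<close>-th power map has
    \<open>e k\<close> fixed points in the cyclic group, and a positive multiple of
    \<open>e k\<close> in \<open>G\<close>.\<close>
  also have "\<dots> \<le> (\<Sum>k\<in>U. card (root_set G (e k)))"
  proof (rule sum_mono)
    fix k
    have "e k dvd card (root_set G (e k))" using dvd_card_root_set[OF fin] by (simp add: e_def n_def)
    moreover have "\<one> \<in> root_set G (e k)" by (simp add: root_set_def)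
    hence "card (root_set G (e k)) > 0" using finite_root_set[OF fin] card_gt_0_iff by blast
    ultimately show "e k \<le> card (root_set G (e k))" using dvd_imp_le by blast
  qed
  also have "\<dots> = (\<Sum>k\<in>U. \<Sum>x\<in>carrier G. if [k = 1] (mod (ord x)) then 1 else 0)"
  proof (rule sum.cong[OF refl])
    fix k
    have "root_set G (e k) = {x \<in> carrier G. [k = 1] (mod (ord x))}"
      using e on by (auto simp: mem_root_set_iff)
    thus "card (root_set G (e k)) = (\<Sum>x\<in>carrier G. if [k = 1] (mod (ord x)) then 1 else 0)"
      using fin by (simp add: sum.inter_filter[symmetric])
  qed
  also have "\<dots> = (\<Sum>x\<in>carrier G. \<Sum>k\<in>U. if [k = 1] (mod (ord x)) then 1 else 0)"
    by (rule sum.swap)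
  also have "\<dots> = (\<Sum>x\<in>carrier G. w (ord x))"
    using finU by (simp add: w_def sum.inter_filter[symmetric])
  \<comment> \<open>A cyclic subgroup with generators of order \<open>d\<close> contributes
    \<open>totient d * w d\<close>, which is \<open>totient n\<close> whatever \<open>d\<close>
    is.\<close>
  also have "\<dots> = (\<Sum>C\<in>cyc. \<Sum>x\<in>{x \<in> carrier G. generate G {x} = C}. w (ord x))"
    unfolding cyc_def by (rule sum.image_gen[OF fin])
  also have "\<dots> = (\<Sum>C\<in>cyc. totient n)"
  proof (rule sum.cong[OF refl])
    fix C assume "C \<in> cyc"
    then obtain y where y: "y \<in> carrier G" "C = generate G {y}" by (auto simp: cyc_def)
    have eq: "{x \<in> carrier G. generate G {x} = C} = {x \<in> generate G {y}. ord x = ord y}"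
      using mem_generators_iff[OF fin y(1)] y(2) by blast
    show "(\<Sum>x\<in>{x \<in> carrier G. generate G {x} = C}. w (ord x)) = totient n"
      unfolding eq using card_generators[OF fin y(1)] w[OF on[OF y(1)]] by (simp add: mult.commute)
  qed
  also have "\<dots> = card cyc * totient n" by simp
  finally have "card {d. d dvd n} \<le> card cyc" using n by simp
  also have "\<dots> \<le> num_subgroups G" unfolding num_subgroups_def
  proof (rule card_mono)
    show "finite {H. subgroup H G}"
      by (rule finite_subset[of _ "Pow (carrier G)"]) (auto simp: fin subgroup.subset dest: subgroup.mem_carrier)
    show "cyc \<subseteq> {H. subgroup H G}" by (auto simp: cyc_def generate_is_subgroup)
  qed
  finally show ?thesis by (simp add: n_def)
qed

section \<open>Groups of squarefree order\<close>

text \<open>Frobenius' argument: remove the primes from the order one by one, the smallest first. If r is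
  to be removed from dr, the number of solutions of x^d = 1 is dj with 0 < j < r, and the remaining
  d(r - j) elements fall into classes of size r - 1, which is prime to d; hence j = 1.\<close>

lemma (in group) card_root_set_upper_hall:
  assumes fin: "finite (carrier G)" and sf: "squarefree (order G)" and d: "d dvd order G"
    and upper: "\<And>q r. prime q \<Longrightarrow> prime r \<Longrightarrow> q dvd d \<Longrightarrow> r dvd order G div d \<Longrightarrow> r < q"
  shows "card (root_set G d) = d"
  using d upper
proof (induction "order G div d" arbitrary: d rule: less_induct)
  case less
  have n0: "order G > 0" using fin order_gt_0_iff_finite by simp
  have d0: "d > 0" using less.prems(1) n0 dvd_pos_nat by blast
  show ?case
  proof (cases "order G div d = 1")
    case True
    hence "order G = d" using less.prems(1) by (metis dvd_mult_div_cancel mult.right_neutral)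
    thus ?thesis using ord_dvd_group_order by (auto simp: order_def mem_root_set_iff intro!: arg_cong[where f = card])
  next
    case False
    define c where "c = order G div d"
    have n: "order G = d * c" using less.prems(1) by (simp add: c_def)
    have c0: "c > 0" using n n0 by (cases c) auto
    \<comment> \<open>With the largest prime of the cofactor, all primes of \<open>d * r\<close>
      stay above those of the remaining cofactor \<open>c'\<close>, so the induction hypothesis
      applies to \<open>d * r\<close>.\<close>
    define r where "r = Max (prime_factors c)"
    have ne: "prime_factors c \<noteq> {}" using False c0
      by (metis c_def empty_iff gcd_nat.extremum_strict prime_factor_nat prime_factorsI not_gr_zero)
    hence "r \<in> prime_factors c" unfolding r_def by (intro Max_in) auto
    hence r: "prime r" "r dvd c" by auto
    have rmax: "q \<le> r" if "prime q" "q dvd c" for q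
      unfolding r_def using that c0 by (intro Max_ge) (auto simp: prime_factors_dvd)
    obtain c' where c': "c = r * c'" using r by auto
    have n': "order G = d * r * c'" using n c' by simp
    have nodvd: "\<not> x * x dvd order G" if "prime x" for x
      using squarefreeD[OF sf, of x] that not_prime_unit by (auto simp: power2_eq_square)
    have rc': "\<not> r dvd c'"
    proof
      assume "r dvd c'"
      hence "r * r dvd order G" unfolding n' by (simp add: mult_dvd_mono mult.assoc dvd_mult)
      thus False using nodvd r by blast
    qed
    have rd: "\<not> r dvd d"
    proof
      assume "r dvd d"
      hence "r * r dvd order G" unfolding n' by (metis dvd_mult2 mult_dvd_mono dvd_refl)
      thus False using nodvd r by blast
    qed
    have dr0: "d * r > 0" using d0 r prime_gt_0_nat by simp
    have "order G div (d * r) = c'" using n' dr0 by simp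
    have fdr: "card (root_set G (d * r)) = d * r"
    proof (rule less.hyps)
      show "order G div (d * r) < order G div d"
        using \<open>order G div (d * r) = c'\<close> c' c0 prime_gt_1_nat[OF r(1)] by (simp flip: c_def)
      show "d * r dvd order G" using n' by simp
      fix q s assume qs: "prime q" "prime s" "q dvd d * r" "s dvd order G div (d * r)"
      hence s: "s dvd c'" using \<open>order G div (d * r) = c'\<close> by simp
      hence sc: "s dvd c" using c' by simp
      have "q dvd d \<or> q dvd r" using qs prime_dvd_mult_iff by blast
      thus "s < q"
      proof
        assume "q dvd d" thus ?thesis using less.prems(2) qs sc by (simp add: c_def)
      next
        assume "q dvd r"
        hence "q = r" using qs r primes_dvd_imp_eq by blast
        moreover have "s \<noteq> r" using s rc' by blast
        ultimately show ?thesis using rmax[OF qs(2) sc] by simp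
      qed
    qed
    let ?A = "root_set G (d * r) - root_set G d"
    have sub: "root_set G d \<subseteq> root_set G (d * r)" by (auto simp: mem_root_set_iff)
    have "totient r dvd card ?A"
    proof (rule totient_dvd_card[OF fin])
      fix x assume "x \<in> ?A"
      hence x: "ord x dvd d * r" "\<not> ord x dvd d" by (auto simp: mem_root_set_iff)
      thus "r dvd ord x" using r(1)
        by (metis coprime_commute coprime_dvd_mult_left_iff prime_imp_coprime)
    qed (auto simp: mem_root_set_iff)
    hence tA: "(r - 1) dvd card ?A" using r by (simp add: totient_prime)
    have card_A: "card ?A = d * r - card (root_set G d)"
      using sub fdr by (simp add: card_Diff_subset finite_root_set fin)
    obtain j where j: "card (root_set G d) = d * j"
      using dvd_card_root_set[OF fin, of d] less.prems(1) by auto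
    have "\<one> \<in> root_set G d" by (simp add: root_set_def)
    hence "card (root_set G d) > 0" using finite_root_set[OF fin] card_gt_0_iff by blast
    hence j0: "j > 0" using j by (cases j) auto
    \<comment> \<open>Cauchy's theorem provides a solution for \<open>d * r\<close> that is none for
      \<open>d\<close>, hence the strict bound \<open>j < r\<close>.\<close>
    obtain y where y: "y \<in> carrier G" "ord y = r" using obtain_ord_eq_prime[OF fin r(1)] n' by (metis dvd_mult2 dvd_triv_right)
    have "y \<in> ?A" using y rd by (simp add: mem_root_set_iff)
    hence "card ?A > 0" using finite_root_set[OF fin] by (metis card_gt_0_iff empty_iff finite_Diff)
    hence jr: "j < r" using card_A j by (metis zero_less_diff mult_less_cancel1)
    \<comment> \<open>Every prime of \<open>d\<close> exceeds \<open>r\<close>, so none can divide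
      \<open>r - 1\<close>.\<close>
    have "coprime (r - 1) d"
    proof (rule ccontr)
      assume "\<not> coprime (r - 1) d"
      then obtain q where q: "prime q" "q dvd r - 1" "q dvd d"
        using common_prime_factor_nat by blast
      have "r < q" using less.prems(2)[OF q(1) r(1) q(3)] r(2) by (simp add: c_def)
      moreover have "q \<le> r - 1" using q(2) prime_gt_1_nat[OF r(1)] by (intro dvd_imp_le) auto
      ultimately show False by simp
    qed
    moreover have "(r - 1) dvd d * (r - j)" using tA card_A j by (simp add: diff_mult_distrib2)
    ultimately have "(r - 1) dvd r - j" using coprime_dvd_mult_right_iff by blast
    hence "r - 1 \<le> r - j" using jr by (intro dvd_imp_le) auto
    hence "j = 1" using j0 jr by simp
    thus ?thesis using j by simp
  qed
qed

text \<open>For a transversal T of P with retraction \<tau>, the elements b g t = g t \<tau>(gt)^-1 of P are multiplied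
  over t in T. The product d is a crossed homomorphism from G to P that restricts to the m-th power
  map on P, where m is the index of P. Since m is prime to the order of P, the kernel of d is a
  complement.\<close>

lemma (in group) abelian_normal_complement:
  assumes fin: "finite (carrier G)" and P: "P \<lhd> G"
    and ab: "\<And>x y. x \<in> P \<Longrightarrow> y \<in> P \<Longrightarrow> x \<otimes> y = y \<otimes> x"
    and cop: "coprime (card P) (order G div card P)"
  obtains K where "subgroup K G" "K \<inter> P = {\<one>}" "card P * card K = order G"
    "\<And>g. g \<in> carrier G \<Longrightarrow> \<exists>x\<in>P. \<exists>k\<in>K. g = x \<otimes> k"
proof -
  have sP: "subgroup P G" using P by (rule normal_imp_subgroup)
  have Pc: "x \<in> carrier G" if "x \<in> P" for x using that subgroup.mem_carrier[OF sP] by simp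
  have conjP: "g \<otimes> x \<otimes> inv g \<in> P" if "g \<in> carrier G" "x \<in> P" for g x
    using that P unfolding normal_inv_iff by blast
  have cancel: "inv x \<otimes> (x \<otimes> y) = y" if "x \<in> carrier G" "y \<in> carrier G" for x y
    using that by (simp add: m_assoc[symmetric])
  let ?P = "G\<lparr>carrier := P\<rparr>"
  interpret PG: group ?P using sP by (rule subgroup_imp_group)
  interpret PG: comm_group ?P by (rule PG.group_comm_groupI) (simp add: ab)
  define m where "m = order G div card P"
  have finP: "finite P" using subgroup.subset[OF sP] fin by (rule finite_subset)
  have mP: "card (rcosets P) * card P = order G" using lagrange[OF sP] .
  have "P \<noteq> {}" using subgroup.one_closed[OF sP] by auto
  hence cP0: "card P > 0" using finP by auto
  have m: "card (rcosets P) = m" using mP cP0 by (simp add: m_def flip: mP)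
  \<comment> \<open>The choice depends on the coset of \<open>h\<close> only, so equal cosets
    automatically have equal representatives.\<close>
  define \<tau> where "\<tau> h = (SOME y. y \<in> P #> h)" for h
  have rself: "h \<in> P #> h" if "h \<in> carrier G" for h using that rcos_self sP by blast
  have \<tau>: "\<tau> h \<in> P #> h" if "h \<in> carrier G" for h
    unfolding \<tau>_def using rself[OF that] by (rule someI)
  have \<tau>c: "\<tau> h \<in> carrier G" if "h \<in> carrier G" for h
    using \<tau>[OF that] that Pc by (auto simp: r_coset_def)
  have \<tau>x: "\<exists>x\<in>P. \<tau> h = x \<otimes> h" if "h \<in> carrier G" for h
    using \<tau>[OF that] by (auto simp: r_coset_def)
  have \<tau>eq: "\<tau> (x \<otimes> h) = \<tau> h" if "x \<in> P" "h \<in> carrier G" for x h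
  proof -
    have "P #> (x \<otimes> h) = P #> h"
      using that repr_independence[of "x \<otimes> h" P h] sP by (auto simp: r_coset_def)
    thus ?thesis by (simp add: \<tau>_def)
  qed
  \<comment> \<open>Normality: changing \<open>h\<close> by a left factor in \<open>P\<close>
    changes \<open>g \<otimes> h\<close> by a conjugate of it, again a left factor in
    \<open>P\<close>.\<close>
  have \<tau>\<tau>: "\<tau> (g \<otimes> \<tau> h) = \<tau> (g \<otimes> h)" if gh: "g \<in> carrier G" "h \<in> carrier G" for g h
  proof -
    obtain x where x: "x \<in> P" "\<tau> h = x \<otimes> h" using \<tau>x gh by blast
    have "g \<otimes> \<tau> h = (g \<otimes> x \<otimes> inv g) \<otimes> (g \<otimes> h)"
      using x gh Pc by (simp add: m_assoc) (simp add: m_assoc[symmetric])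
    thus ?thesis using \<tau>eq conjP gh x by simp
  qed
  define T where "T = \<tau> ` carrier G"
  have Tc: "t \<in> carrier G" if "t \<in> T" for t using that \<tau>c by (auto simp: T_def)
  have \<tau>T: "\<tau> t = t" if "t \<in> T" for t
    using that \<tau>\<tau>[of \<one>] \<tau>c by (auto simp: T_def)
  have \<tau>in: "\<tau> h \<in> T" if "h \<in> carrier G" for h using that by (simp add: T_def)
  have finT: "finite T" using fin by (simp add: T_def)
  have cardT: "card T = m"
  proof -
    have "bij_betw (\<lambda>t. P #> t) T (rcosets P)"
    proof (rule bij_betw_imageI)
      show "inj_on (\<lambda>t. P #> t) T" by (rule inj_onI) (metis \<tau>T \<tau>_def)
      have "P #> h \<in> (\<lambda>t. P #> t) ` T" if h: "h \<in> carrier G" for h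
        using repr_independence[OF \<tau>[OF h] h sP] \<tau>in[OF h] by blast
      thus "(\<lambda>t. P #> t) ` T = rcosets P" using Tc by (auto simp: RCOSETS_def)
    qed
    thus ?thesis using m bij_betw_same_card by metis
  qed
  define b where "b g t = g \<otimes> t \<otimes> inv (\<tau> (g \<otimes> t))" for g t
  have bP: "b g t \<in> P" if gt: "g \<in> carrier G" "t \<in> carrier G" for g t
  proof -
    obtain x where x: "x \<in> P" "\<tau> (g \<otimes> t) = x \<otimes> (g \<otimes> t)" using \<tau>x gt by blast
    hence "b g t = g \<otimes> t \<otimes> (inv (g \<otimes> t) \<otimes> inv x)"
      using gt Pc inv_mult_group[of x "g \<otimes> t"] by (simp add: b_def)
    also have "\<dots> = inv x" using gt Pc x by (simp add: m_assoc[symmetric] del: inv_mult_group)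
    finally show ?thesis using x subgroup.m_inv_closed[OF sP] by simp
  qed
  define d where "d g = finprod ?P (b g) T" for g
  have dP: "d g \<in> P" if "g \<in> carrier G" for g
    using PG.finprod_closed[of "b g" T] bP[OF that] Tc by (auto simp: d_def)
  have perm: "bij_betw (\<lambda>t. \<tau> (g \<otimes> t)) T T" if g: "g \<in> carrier G" for g
  proof (rule bij_betw_byWitness[where f' = "\<lambda>t. \<tau> (inv g \<otimes> t)"])
    show "\<forall>t\<in>T. \<tau> (inv g \<otimes> \<tau> (g \<otimes> t)) = t" "\<forall>t\<in>T. \<tau> (g \<otimes> \<tau> (inv g \<otimes> t)) = t"
      using g Tc \<tau>T by (simp_all add: \<tau>\<tau> m_assoc[symmetric])
  qed (use g Tc \<tau>in in auto)
  have conj_finprod: "finprod ?P (\<lambda>t. g \<otimes> f t \<otimes> inv g) A = g \<otimes> finprod ?P f A \<otimes> inv g"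
    if g: "g \<in> carrier G" and f: "f \<in> A \<rightarrow> P" and A: "finite A" for g f A
    using A f
  proof (induction A)
    case empty
    then show ?case using g by simp
  next
    case (insert a A)
    have "finprod ?P f A \<in> P" using insert.prems PG.finprod_closed[of f A] by auto
    thus ?case using insert g conjP Pc by (simp add: PG.finprod_insert Pi_iff conj_mult)
  qed
  have dmult: "d (g \<otimes> h) = (g \<otimes> d h \<otimes> inv g) \<otimes> d g" if gh: "g \<in> carrier G" "h \<in> carrier G" for g h
  proof -
    \<comment> \<open>The representative of \<open>h \<otimes> t\<close> cancels between the two
      factors. Multiplying these identities over \<open>T\<close> gives the law for
      \<open>d\<close>.\<close>
    have bb: "b (g \<otimes> h) t = (g \<otimes> b h t \<otimes> inv g) \<otimes> b g (\<tau> (h \<otimes> t))" if t: "t \<in> T" for t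
    proof -
      have c: "t \<in> carrier G" "\<tau> (h \<otimes> t) \<in> carrier G" "\<tau> (g \<otimes> (h \<otimes> t)) \<in> carrier G"
        using t gh Tc \<tau>c by auto
      have "(g \<otimes> b h t \<otimes> inv g) \<otimes> b g (\<tau> (h \<otimes> t)) = g \<otimes> h \<otimes> t \<otimes> inv (\<tau> (g \<otimes> (h \<otimes> t)))"
        using c gh by (simp add: b_def \<tau>\<tau> m_assoc cancel)
      thus ?thesis using c gh by (simp add: b_def m_assoc)
    qed
    have "d (g \<otimes> h) = finprod ?P (\<lambda>t. (g \<otimes> b h t \<otimes> inv g) \<otimes>\<^bsub>?P\<^esub> b g (\<tau> (h \<otimes> t))) T"
      unfolding d_def
      by (rule PG.finprod_cong') (use bb gh Tc \<tau>c bP conjP subgroup.m_closed[OF sP] in auto)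
    also have "\<dots> = finprod ?P (\<lambda>t. g \<otimes> b h t \<otimes> inv g) T \<otimes> finprod ?P (\<lambda>t. b g (\<tau> (h \<otimes> t))) T"
      using gh Tc \<tau>c bP conjP by (subst PG.finprod_multf) auto
    also have "finprod ?P (\<lambda>t. g \<otimes> b h t \<otimes> inv g) T = g \<otimes> d h \<otimes> inv g"
      unfolding d_def using gh bP Tc finT by (intro conj_finprod) auto
    \<comment> \<open>Left multiplication by \<open>h\<close> permutes the cosets and thus the
      transversal, so the reindexed product is \<open>d g\<close>.\<close>
    also have "finprod ?P (\<lambda>t. b g (\<tau> (h \<otimes> t))) T = finprod ?P (b g) ((\<lambda>t. \<tau> (h \<otimes> t)) ` T)"
      using perm[OF gh(2)] gh bP Tc by (intro PG.finprod_reindex[symmetric]) (auto simp: bij_betw_def)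
    also have "(\<lambda>t. \<tau> (h \<otimes> t)) ` T = T" using perm[OF gh(2)] by (simp add: bij_betw_def)
    finally show ?thesis by (simp add: d_def)
  qed
  have dx: "d x = x [^] m" if x: "x \<in> P" for x
  proof -
    have "b x t = x" if "t \<in> T" for t
      using that x Pc Tc \<tau>T by (simp add: b_def \<tau>eq m_assoc)
    hence "d x = finprod ?P (\<lambda>_. x) T"
      unfolding d_def using x by (intro PG.finprod_cong') auto
    also have "\<dots> = x [^]\<^bsub>?P\<^esub> m" using x by (simp add: PG.finprod_const cardT)
    finally show ?thesis by (simp add: nat_pow_consistent[symmetric])
  qed
  have powP: "x [^] card P = \<one>" if "x \<in> P" for x
    using PG.pow_order_eq_1[of x] that by (simp add: order_def nat_pow_consistent[symmetric])
  have xm: "x [^] m = \<one> \<Longrightarrow> x = \<one>" if "x \<in> P" for x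
  proof -
    assume "x [^] m = \<one>"
    hence "ord x dvd m" "ord x dvd card P" using powP[OF that] pow_eq_id Pc[OF that] by auto
    hence "ord x = 1" using cop m_def by (metis coprime_common_divisor_nat)
    thus "x = \<one>" using ord_eq_1 Pc[OF that] by simp
  qed
  define K where "K = {g \<in> carrier G. d g = \<one>}"
  have d1: "d \<one> = \<one>" using dx[OF subgroup.one_closed[OF sP]] by simp
  have sK: "subgroup K G"
  proof (rule subgroupI)
    show "K \<subseteq> carrier G" by (auto simp: K_def)
    show "K \<noteq> {}" using d1 by (auto simp: K_def)
  next
    fix a assume a: "a \<in> K"
    hence ac: "a \<in> carrier G" "d a = \<one>" by (auto simp: K_def)
    have "\<one> = a \<otimes> d (inv a) \<otimes> inv a" using dmult[of a "inv a"] ac d1 Pc[OF dP] by simp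
    hence "d (inv a) = \<one>" using conj_eq_one_iff[of a "d (inv a)"] ac Pc[OF dP] by simp
    thus "inv a \<in> K" using ac by (simp add: K_def)
  next
    fix a b assume "a \<in> K" "b \<in> K"
    thus "a \<otimes> b \<in> K" using dmult[of a b] by (simp add: K_def)
  qed
  have KP: "K \<inter> P = {\<one>}"
    using xm dx subgroup.one_closed[OF sP] subgroup.one_closed[OF sK] by (auto simp: K_def)
  have factor: "\<exists>x\<in>P. \<exists>k\<in>K. g = x \<otimes> k" if g: "g \<in> carrier G" for g
  proof -
    \<comment> \<open>As \<open>u\<close> inverts \<open>m\<close> modulo the order of
      \<open>P\<close>, the \<open>u\<close>-th power is an \<open>m\<close>-th root in
      \<open>P\<close>. The root \<open>x\<close> of \<open>d g\<close> satisfies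
      \<open>d x = d g\<close>, and dividing it out moves \<open>g\<close> into the kernel.\<close>
    obtain u where u: "[m * u = 1] (mod (card P))"
      using cong_solve_coprime_nat[of m "card P"] cop m_def by (auto simp: coprime_commute)
    define x where "x = d g [^] u"
    have dgP: "d g \<in> P" using dP g by simp
    have xP: "x \<in> P" unfolding x_def
      using PG.nat_pow_closed[of "d g" u] dgP by (simp add: nat_pow_consistent[symmetric])
    have "x [^] m = d g [^] (m * u)" using Pc[OF dgP] by (simp add: x_def nat_pow_pow mult.commute)
    also have "\<dots> = d g" using pow_eq_self[OF Pc[OF dgP] powP[OF dgP] u] .
    finally have xm': "x [^] m = d g" .
    have ixP: "inv x \<in> P" using xP subgroup.m_inv_closed[OF sP] by simp
    have "d (inv x \<otimes> g) = (inv x \<otimes> d g \<otimes> inv (inv x)) \<otimes> d (inv x)"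
      using dmult[OF Pc[OF ixP] g] .
    also have "inv x \<otimes> d g \<otimes> inv (inv x) = d g"
      using ab[OF ixP dgP] Pc[OF dgP] Pc[OF xP] by (simp add: m_assoc)
    also have "d (inv x) = inv (d g)" using dx[OF ixP] xm' Pc[OF xP] by (simp add: nat_pow_inv)
    finally have "d (inv x \<otimes> g) = \<one>" using Pc[OF dgP] by simp
    hence "inv x \<otimes> g \<in> K" using g Pc[OF xP] by (simp add: K_def)
    moreover have "g = x \<otimes> (inv x \<otimes> g)" using g Pc[OF xP] by (simp add: m_assoc[symmetric])
    ultimately show ?thesis using xP by blast
  qed
  have Kc: "k \<in> carrier G" if "k \<in> K" for k using that by (simp add: K_def)
  have "bij_betw (\<lambda>(x, k). x \<otimes> k) (P \<times> K) (carrier G)"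
  proof (rule bij_betw_imageI)
    show "inj_on (\<lambda>(x, k). x \<otimes> k) (P \<times> K)"
    proof (rule inj_onI, clarify)
      fix x k y l assume *: "x \<in> P" "k \<in> K" "y \<in> P" "l \<in> K" "x \<otimes> k = y \<otimes> l"
      have eq: "inv y \<otimes> x = l \<otimes> inv k"
      proof -
        have "inv y \<otimes> x = inv y \<otimes> (x \<otimes> k) \<otimes> inv k" using *(1-4) Pc Kc by (simp add: m_assoc)
        also have "\<dots> = inv y \<otimes> (y \<otimes> l) \<otimes> inv k" using * by simp
        also have "\<dots> = l \<otimes> inv k" using *(1-4) Pc Kc by (simp add: m_assoc[symmetric])
        finally show ?thesis .
      qed
      have "inv y \<otimes> x \<in> P" using * subgroup.m_closed[OF sP] subgroup.m_inv_closed[OF sP] by simp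
      moreover have "inv y \<otimes> x \<in> K" unfolding eq
        using * subgroup.m_closed[OF sK] subgroup.m_inv_closed[OF sK] by simp
      ultimately have "inv y \<otimes> x = \<one>" using KP by blast
      hence "x = y" using * Pc by (metis inv_equality inv_inv inv_closed)
      thus "x = y \<and> k = l" using * Pc Kc by simp
    qed
    show "(\<lambda>(x, k). x \<otimes> k) ` (P \<times> K) = carrier G" using factor Pc Kc by force
  qed
  hence "card P * card K = order G" using bij_betw_same_card by (fastforce simp: card_cartesian_product order_def)
  thus ?thesis using that sK KP factor by blast
qed

lemma squarefree_mult_imp_coprime_nat:
  fixes a b :: nat
  assumes "squarefree (a * b)"
  shows "coprime a b"
proof (rule ccontr)
  assume "\<not> coprime a b"
  then obtain p where p: "prime p" "p dvd a" "p dvd b" using common_prime_factor_nat by blast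
  hence "p\<^sup>2 dvd a * b" unfolding power2_eq_square by (intro mult_dvd_mono)
  thus False using squarefreeD[OF assms] p(1) not_prime_unit by blast
qed

section \<open>Subgroups of cyclic groups, and subgroups relative to a normal subgroup with
  complement\<close>

context group
begin

lemma finite_subgroups: "finite (carrier G) \<Longrightarrow> finite {H. subgroup H G}"
  by (rule finite_subset[of _ "Pow (carrier G)"]) (auto dest: subgroup.mem_carrier)

lemma num_subgroups_restrict:
  assumes "subgroup K G"
  shows "num_subgroups (G\<lparr>carrier := K\<rparr>) = card {H. subgroup H G \<and> H \<subseteq> K}"
proof -
  have "subgroup H (G\<lparr>carrier := K\<rparr>) \<longleftrightarrow> subgroup H G \<and> H \<subseteq> K" for H
    using incl_subgroup[OF assms] subgroup_incl[OF _ assms]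
    by (metis partial_object.select_convs(1) partial_object.surjective partial_object.update_convs(1) subgroup.subset)
  thus ?thesis by (simp add: num_subgroups_def)
qed

lemma cyclic_group_iff_ord:
  assumes fin: "finite (carrier G)"
  shows "cyclic_group G \<longleftrightarrow> (\<exists>x\<in>carrier G. ord x = order G)"
proof -
  have "carrier G = range (\<lambda>n::int. x [^] n) \<longleftrightarrow> ord x = order G" if x: "x \<in> carrier G" for x
  proof -
    have gen: "generate G {x} = range (\<lambda>n::int. x [^] n)" by (auto simp: generate_pow[OF x])
    have sub: "generate G {x} \<subseteq> carrier G" using x generate_incl by simp
    show ?thesis unfolding generate_pow_card[OF x] order_def
      using card_subset_eq[OF fin sub] gen by metis
  qed
  thus ?thesis unfolding cyclic_group by auto
qed

text \<open>If \<open>x\<close> generates and the order is \<open>d * c\<close>, a power of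
  \<open>x\<close> is a solution only if \<open>c\<close> divides the exponent; modulo the order at
  most \<open>d\<close> such exponents remain.\<close>

lemma card_root_set_cyclic_le:
  assumes fin: "finite (carrier G)" and cyc: "cyclic_group G" and d: "d dvd order G"
  shows "card (root_set G d) \<le> d"
proof -
  obtain x where x: "x \<in> carrier G" "ord x = order G" using cyc cyclic_group_iff_ord[OF fin] by auto
  obtain c where c: "order G = d * c" using d by blast
  have n0: "order G > 0" using fin order_gt_0_iff_finite by simp
  have "generate G {x} = carrier G"
    using x generate_incl[of "{x}"] fin by (intro card_subset_eq) (auto simp: generate_pow_card[symmetric] order_def)
  hence elems: "carrier G = {x [^] k | k. k \<in> (UNIV :: nat set)}"
    using generate_pow_on_finite_carrier[OF fin x(1)] by simp
  have "root_set G d \<subseteq> (\<lambda>j. x [^] (c * j)) ` {..<d}"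
  proof
    fix y assume y: "y \<in> root_set G d"
    then obtain k :: nat where k: "y = x [^] k" using elems by (auto simp: root_set_def)
    have "x [^] (k * d) = \<one>" using y k x by (simp add: root_set_def nat_pow_pow)
    hence "d * c dvd k * d" using pow_eq_id x c by simp
    hence "c dvd k" using n0 c by (simp add: mult.commute)
    then obtain j where j: "k = c * j" by blast
    have "c * j = c * (j mod d) + order G * (j div d)"
      unfolding c by (metis distrib_left mod_mult_div_eq mult.assoc mult.commute)
    hence "x [^] k = x [^] (c * (j mod d)) \<otimes> (x [^] order G) [^] (j div d)"
      using j x by (simp add: nat_pow_mult nat_pow_pow)
    hence "y = x [^] (c * (j mod d))" using k x pow_order_eq_1 by simp
    moreover have "j mod d < d" using n0 c by (intro mod_less_divisor) (cases d; simp)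
    ultimately show "y \<in> (\<lambda>j. x [^] (c * j)) ` {..<d}" by blast
  qed
  thus ?thesis using card_mono[of "(\<lambda>j. x [^] (c * j)) ` {..<d}"] card_image_le[of "{..<d}"]
    by (metis card_lessThan dual_order.trans finite_imageI finite_lessThan)
qed

lemma subgroup_card_dvd_order: "subgroup H G \<Longrightarrow> card H dvd order G"
  using lagrange by (metis dvd_triv_right)

text \<open>By Lagrange, \<open>H\<close> consists of solutions of \<open>x^(card H) = 1\<close>,
  and a cyclic group has no room for others. So a subgroup of a cyclic group is determined by its
  order.\<close>

lemma subgroup_cyclic_eq_root_set:
  assumes fin: "finite (carrier G)" and cyc: "cyclic_group G" and H: "subgroup H G"
  shows "H = root_set G (card H)"
proof (rule card_seteq[OF finite_root_set[OF fin]])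
  interpret H: group "G\<lparr>carrier := H\<rparr>" using H by (rule subgroup_imp_group)
  show "H \<subseteq> root_set G (card H)"
    using H.pow_order_eq_1 subgroup.mem_carrier[OF H]
    by (auto simp: root_set_def order_def nat_pow_consistent[symmetric])
  show "card (root_set G (card H)) \<le> card H"
    using card_root_set_cyclic_le[OF fin cyc subgroup_card_dvd_order[OF H]] .
qed

text \<open>The parameter \<open>c\<close> covers two uses: the order of the group bounds all its
  subgroups, the order of a proper subgroup bounds those lying inside it.\<close>

lemma card_subgroups_cyclic_le:
  assumes fin: "finite (carrier G)" and cyc: "cyclic_group G" and c: "c > 0"
  shows "card {H. subgroup H G \<and> card H dvd c} \<le> card {d. d dvd c}"
proof (rule card_inj_on_le[where f = card])
  show "inj_on card {H. subgroup H G \<and> card H dvd c}"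
    using subgroup_cyclic_eq_root_set[OF fin cyc] by (metis (mono_tags, lifting) inj_onI mem_Collect_eq)
qed (use c in auto)

text \<open>Dedekind's modular law. It recovers \<open>H\<close> from \<open>P <#> H\<close>, so
  distinct subgroups of \<open>K\<close> have distinct products with \<open>P\<close>.\<close>

lemma mult_normal_Int:
  assumes P: "P \<lhd> G" and H: "subgroup H G" "H \<subseteq> K" and K: "subgroup K G" "K \<inter> P = {\<one>}"
  shows "(P <#> H) \<inter> K = H"
proof (intro equalityI subsetI)
  have sP: "subgroup P G" using P by (rule normal_imp_subgroup)
  fix y assume "y \<in> (P <#> H) \<inter> K"
  then obtain x h where x: "x \<in> P" "h \<in> H" "y = x \<otimes> h" "y \<in> K" by (auto simp: set_mult_def)
  have c: "x \<in> carrier G" "h \<in> carrier G"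
    using x subgroup.mem_carrier[OF sP] subgroup.mem_carrier[OF H(1)] by auto
  have "y \<otimes> inv h \<in> K" 
    using subgroup.m_closed[OF K(1) x(4) subgroup.m_inv_closed[OF K(1), of h]] x(2) H(2) by auto
  moreover have "y \<otimes> inv h = x" using x(3) c by (simp add: m_assoc)
  ultimately have "x = \<one>" using K(2) x(1) by blast
  thus "y \<in> H" using x c by simp
next
  have sP: "subgroup P G" using P by (rule normal_imp_subgroup)
  fix y assume y: "y \<in> H"
  hence "y = \<one> \<otimes> y" using subgroup.mem_carrier[OF H(1)] by simp
  moreover have "\<one> \<in> P" using subgroup.one_closed[OF sP] .
  ultimately have "y \<in> P <#> H" using y unfolding set_mult_def by blast
  thus "y \<in> (P <#> H) \<inter> K" using y H by auto
qed

lemma subset_mult_subgroup: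
  assumes "P \<subseteq> carrier G" "subgroup H G" shows "P \<subseteq> P <#> H"
proof
  fix x assume x: "x \<in> P"
  hence "x = x \<otimes> \<one>" using assms by auto
  thus "x \<in> P <#> H" using x subgroup.one_closed[OF assms(2)] unfolding set_mult_def by blast
qed

lemma card_subgroups_above_normal:
  assumes fin: "finite (carrier G)" and P: "P \<lhd> G" and K: "subgroup K G" "K \<inter> P = {\<one>}"
  shows "card {H. subgroup H G \<and> H \<subseteq> K} \<le> card {H. subgroup H G \<and> P \<subseteq> H}"
proof (rule card_inj_on_le[where f = "\<lambda>H. P <#> H"])
  show "inj_on (\<lambda>H. P <#> H) {H. subgroup H G \<and> H \<subseteq> K}"
    using mult_normal_Int[OF P _ _ K] by (intro inj_onI) (metis (mono_tags, lifting) mem_Collect_eq)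
  show "(\<lambda>H. P <#> H) ` {H. subgroup H G \<and> H \<subseteq> K} \<subseteq> {H. subgroup H G \<and> P \<subseteq> H}"
    using mult_norm_subgroup[OF P] subset_mult_subgroup subgroup.subset[OF normal_imp_subgroup[OF P]] by auto
  show "finite {H. subgroup H G \<and> P \<subseteq> H}"
    using finite_subgroups[OF fin] by (rule rev_finite_subset) auto
qed

lemma num_subgroups_split:
  assumes fin: "finite (carrier G)"
  shows "num_subgroups G = card {H. subgroup H G \<and> P \<subseteq> H} + card {H. subgroup H G \<and> \<not> P \<subseteq> H}"
proof -
  let ?A = "{H. subgroup H G \<and> P \<subseteq> H}" and ?B = "{H. subgroup H G \<and> \<not> P \<subseteq> H}"
  have "finite ?A" "finite ?B"
    using finite_subgroups[OF fin] by (auto elim: rev_finite_subset)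
  moreover have "?A \<inter> ?B = {}" by blast
  ultimately have "card (?A \<union> ?B) = card ?A + card ?B" by (rule card_Un_disjoint)
  moreover have "?A \<union> ?B = {H. subgroup H G}" by blast
  ultimately show ?thesis by (simp add: num_subgroups_def)
qed

lemma twice_card_subgroups_complement_le:
  assumes fin: "finite (carrier G)" and P: "P \<lhd> G" "P \<noteq> {\<one>}" and K: "subgroup K G" "K \<inter> P = {\<one>}"
  shows "2 * card {H. subgroup H G \<and> H \<subseteq> K} \<le> num_subgroups G"
proof -
  have "card {H. subgroup H G \<and> H \<subseteq> K} \<le> card {H. subgroup H G \<and> \<not> P \<subseteq> H}"
  proof (rule card_mono)
    show "finite {H. subgroup H G \<and> \<not> P \<subseteq> H}"
      using finite_subgroups[OF fin] by (rule rev_finite_subset) auto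
    have "P \<subseteq> {\<one>}" if "P \<subseteq> H" "H \<subseteq> K" for H using that K(2) by blast
    moreover have "\<one> \<in> P" using subgroup.one_closed[OF normal_imp_subgroup[OF P(1)]] .
    ultimately show "{H. subgroup H G \<and> H \<subseteq> K} \<subseteq> {H. subgroup H G \<and> \<not> P \<subseteq> H}" using P(2) by blast
  qed
  thus ?thesis using card_subgroups_above_normal[OF fin P(1) K] num_subgroups_split[OF fin, of P] by simp
qed

lemma subgroup_conj:
  assumes x: "x \<in> carrier G" and H: "subgroup H G"
  shows "subgroup ((\<lambda>h. x \<otimes> h \<otimes> inv x) ` H) G"
proof (rule subgroupI)
  have Hc: "h \<in> carrier G" if "h \<in> H" for h using that subgroup.mem_carrier[OF H] by simp
  show "(\<lambda>h. x \<otimes> h \<otimes> inv x) ` H \<subseteq> carrier G" using x Hc by auto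
  show "(\<lambda>h. x \<otimes> h \<otimes> inv x) ` H \<noteq> {}" using subgroup.one_closed[OF H] by auto
  fix a assume "a \<in> (\<lambda>h. x \<otimes> h \<otimes> inv x) ` H"
  then obtain h where h: "h \<in> H" "a = x \<otimes> h \<otimes> inv x" by auto
  have "inv a = x \<otimes> inv h \<otimes> inv x" using h x Hc by (simp add: inv_mult_group m_assoc)
  thus "inv a \<in> (\<lambda>h. x \<otimes> h \<otimes> inv x) ` H" using subgroup.m_inv_closed[OF H h(1)] by blast
  fix b assume "b \<in> (\<lambda>h. x \<otimes> h \<otimes> inv x) ` H"
  then obtain l where l: "l \<in> H" "b = x \<otimes> l \<otimes> inv x" by auto
  have "a \<otimes> b = x \<otimes> (h \<otimes> l) \<otimes> inv x" using h l x Hc by (simp add: conj_mult)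
  thus "a \<otimes> b \<in> (\<lambda>h. x \<otimes> h \<otimes> inv x) ` H" using subgroup.m_closed[OF H h(1) l(1)] by blast
qed

lemma card_conj_image:
  assumes "x \<in> carrier G" "H \<subseteq> carrier G"
  shows "card ((\<lambda>h. x \<otimes> h \<otimes> inv x) ` H) = card H"
  using assms by (intro card_image inj_onI) (metis conj_inv_conj subsetD)

lemma prime_subgroup_generated:
  assumes P: "subgroup P G" and p: "prime (card P)" and z: "z \<in> P" "z \<noteq> \<one>"
  shows "generate G {z} = P"
proof -
  interpret P: group "G\<lparr>carrier := P\<rparr>" using P by (rule subgroup_imp_group)
  have finP: "finite P" using p by (metis card.infinite not_prime_0)
  have sub: "generate G {z} \<subseteq> P" using z P by (intro generate_subgroup_incl) auto
  have zc: "z \<in> carrier G" using z subgroup.mem_carrier[OF P] by simp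
  have sg: "subgroup (generate G {z}) G" using zc by (intro generate_is_subgroup) auto
  have "card (generate G {z}) dvd card P"
    using P.subgroup_card_dvd_order[OF subgroup_incl[OF sg P sub]] by (simp add: order_def)
  moreover have "card (generate G {z}) \<noteq> 1"
    using z generate_pow_card[OF zc] ord_eq_1[OF zc] by simp
  ultimately have "card (generate G {z}) = card P" using p by (metis prime_nat_iff)
  thus ?thesis using sub finP by (simp add: card_subset_eq)
qed

text \<open>The element \<open>z = inv y \<otimes> x\<close> normalizes \<open>H\<close>. For
  \<open>h\<close> in \<open>H\<close>, the commutator of \<open>z\<close> and \<open>h\<close> lies
  in \<open>H\<close>, and by normality in \<open>P\<close>, so it is trivial. Thus \<open>z\<close>
  centralizes \<open>H\<close>, and so does \<open>P\<close>, which is generated by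
  \<open>z\<close>.\<close>

lemma conj_subgroup_eq_imp_centralizes:
  assumes P: "P \<lhd> G" "prime (card P)" and H: "subgroup H G" "H \<inter> P \<subseteq> {\<one>}"
    and xy: "x \<in> P" "y \<in> P" "x \<noteq> y"
    and eq: "(\<lambda>h. x \<otimes> h \<otimes> inv x) ` H = (\<lambda>h. y \<otimes> h \<otimes> inv y) ` H"
    and h: "h \<in> H" and u: "u \<in> P"
  shows "u \<otimes> h = h \<otimes> u"
proof -
  have sP: "subgroup P G" using P(1) by (rule normal_imp_subgroup)
  have Pc: "x \<in> carrier G" if "x \<in> P" for x using that subgroup.mem_carrier[OF sP] by simp
  have Hc: "h \<in> carrier G" if "h \<in> H" for h using that subgroup.mem_carrier[OF H(1)] by simp
  have conjP: "g \<otimes> x \<otimes> inv g \<in> P" if "g \<in> carrier G" "x \<in> P" for g x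
    using that P(1) unfolding normal_inv_iff by blast
  have c: "x \<in> carrier G" "y \<in> carrier G" "h \<in> carrier G" using xy h Pc Hc by auto
  define z where "z = inv y \<otimes> x"
  have zP: "z \<in> P" using xy subgroup.m_closed[OF sP] subgroup.m_inv_closed[OF sP] by (simp add: z_def)
  have z1: "z \<noteq> \<one>" using xy(3) c unfolding z_def by (metis inv_equality inv_inv inv_closed)
  have zc: "z \<in> carrier G" using zP Pc by simp
  obtain l where l: "l \<in> H" "x \<otimes> h \<otimes> inv x = y \<otimes> l \<otimes> inv y" using eq h by blast
  have "z \<otimes> h \<otimes> inv z = inv y \<otimes> (x \<otimes> h \<otimes> inv x) \<otimes> y"
    using c by (simp add: z_def inv_mult_group m_assoc)
  also have "\<dots> = l" using l conj_inv_conj[of y l] c Hc by simp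
  finally have zl: "z \<otimes> h \<otimes> inv z = l" .
  have "l \<otimes> inv h \<in> H" using l h subgroup.m_closed[OF H(1)] subgroup.m_inv_closed[OF H(1)] by simp
  moreover have "l \<otimes> inv h = z \<otimes> (h \<otimes> inv z \<otimes> inv h)"
    unfolding zl[symmetric] using c zc by (simp add: m_assoc)
  moreover have "z \<otimes> (h \<otimes> inv z \<otimes> inv h) \<in> P"
    using zP conjP[OF c(3)] subgroup.m_closed[OF sP] subgroup.m_inv_closed[OF sP] by simp
  ultimately have "l \<otimes> inv h = \<one>" using H(2) by auto
  hence "l = h" using c Hc[OF l(1)] by (metis inv_equality inv_inv inv_closed)
  hence "z \<otimes> h = h \<otimes> z" using zl c zc by (metis inv_solve_right' m_closed)
  hence "z \<in> centralizer G h" using zc by (simp add: centralizer_def)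
  hence "generate G {z} \<subseteq> centralizer G h"
    using c by (intro generate_subgroup_incl subgroup_centralizer) auto
  thus ?thesis using prime_subgroup_generated[OF sP P(2) zP z1] u by (auto simp: centralizer_def)
qed

text \<open>Take a nontrivial \<open>x\<close> in \<open>P\<close> and a generator \<open>y\<close>
  of \<open>K\<close>. They commute, and if a power of \<open>x \<otimes> y\<close> is trivial, the
  same power of \<open>x\<close> lies in both \<open>P\<close> and \<open>K\<close>. Hence the
  orders of both factors divide the exponent.\<close>

lemma cyclic_group_mult_complement:
  assumes fin: "finite (carrier G)" and P: "P \<lhd> G" "prime (card P)"
    and K: "subgroup K G" "K \<inter> P = {\<one>}" "card P * card K = order G"
    and cop: "coprime (card P) (card K)" and cyc: "cyclic_group (G\<lparr>carrier := K\<rparr>)"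
    and comm: "\<And>x k. x \<in> P \<Longrightarrow> k \<in> K \<Longrightarrow> x \<otimes> k = k \<otimes> x"
  shows "cyclic_group G"
proof -
  have sP: "subgroup P G" using P(1) by (rule normal_imp_subgroup)
  interpret KG: group "G\<lparr>carrier := K\<rparr>" using K(1) by (rule subgroup_imp_group)
  interpret PG: group "G\<lparr>carrier := P\<rparr>" using sP by (rule subgroup_imp_group)
  have finK: "finite (carrier (G\<lparr>carrier := K\<rparr>))" using fin subgroup.subset[OF K(1)] finite_subset by auto
  obtain y where y: "y \<in> K" "KG.ord y = card K"
    using cyc KG.cyclic_group_iff_ord[OF finK] by (auto simp: order_def)
  have "P \<noteq> {\<one>}" using P(2) by auto
  then obtain x where x: "x \<in> P" "x \<noteq> \<one>" using subgroup.one_closed[OF sP] by blast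
  have c: "x \<in> carrier G" "y \<in> carrier G"
    using x y subgroup.mem_carrier[OF sP] subgroup.mem_carrier[OF K(1)] by auto
  have ox: "ord x = card P" using generate_pow_card[OF c(1)] prime_subgroup_generated[OF sP P(2) x] by simp
  have oy: "y [^] n = \<one> \<longleftrightarrow> card K dvd n" for n :: nat
    using KG.pow_eq_id[of y n] y by (simp add: nat_pow_consistent[symmetric])
  define N where "N = ord (x \<otimes> y)"
  have "x [^] N \<otimes> y [^] N = \<one>"
    using pow_ord_eq_1[of "x \<otimes> y"] c pow_mult_distrib[OF comm[OF x(1) y(1)] c, of N] by (simp add: N_def)
  hence inv: "x [^] N = inv (y [^] N)" using c by (simp add: inv_equality)
  have "y [^] N \<in> K" "x [^] N \<in> P"
    using KG.nat_pow_closed[of y N] PG.nat_pow_closed[of x N] x y by (auto simp: nat_pow_consistent[symmetric])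
  hence "x [^] N = \<one>" using inv subgroup.m_inv_closed[OF K(1)] K(2) by (metis IntI singletonD)
  moreover from this have "y [^] N = \<one>" using inv c by (metis inv_eq_1_iff nat_pow_closed)
  ultimately have "card P dvd N" "card K dvd N" using oy ox pow_eq_id[OF c(1)] by auto
  hence "order G dvd N" using cop K(3) by (metis divides_mult)
  moreover have "N dvd order G" using ord_dvd_group_order c by (simp add: N_def)
  ultimately have "ord (x \<otimes> y) = order G" by (simp add: N_def dvd_antisym)
  thus ?thesis using cyclic_group_iff_ord[OF fin] c by (metis m_closed)
qed

end

text \<open>A proper divisor of a squarefree number lacks one of its primes, and each prime doubles
  the number of divisors. This is the source of the half in the noncyclic case.\<close>

lemma card_divisors_proper_squarefree:
  fixes c m :: nat
  assumes sf: "squarefree m" and c: "c dvd m" "c \<noteq> m"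
  shows "2 * card {d. d dvd c} \<le> card {d. d dvd m}"
proof -
  obtain b where b: "m = c * b" using c by blast
  have m0: "m > 0" using sf by (cases m) auto
  have "b \<noteq> 1" using c b by simp
  then obtain q where q: "prime q" "q dvd b" using prime_factor_nat by blast
  then obtain a where a: "b = q * a" by blast
  have "\<not> q dvd c"
  proof
    assume "q dvd c"
    hence "q\<^sup>2 dvd m" unfolding b power2_eq_square using q by (intro mult_dvd_mono)
    thus False using squarefreeD[OF sf] q not_prime_unit by blast
  qed
  hence "q \<in> prime_factors m - prime_factors c" using q b m0 by (auto simp: prime_factors_dvd)
  moreover have "prime_factors c \<subseteq> prime_factors m" using c m0 by (auto simp: prime_factors_dvd intro: dvd_trans)
  ultimately have "prime_factors c \<subset> prime_factors m" by blast
  hence "Suc (card (prime_factors c)) \<le> card (prime_factors m)" by (simp add: psubset_card_mono Suc_leI)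
  hence "(2::nat) ^ Suc (card (prime_factors c)) \<le> 2 ^ card (prime_factors m)" by (intro power_increasing) auto
  thus ?thesis using card_divisors_squarefree[OF sf] card_divisors_squarefree[OF squarefree_mono[OF c(1) sf]] by simp
qed

context group
begin

text \<open>The subgroups not containing P include the p conjugates under P of every subgroup of K not
  centralized by P; since the centralizer of P in K is proper, at least half of the subgroups
  of K are of this kind.\<close>

lemma thrice_card_subgroups_complement_le:
  assumes fin: "finite (carrier G)" and sf: "squarefree (order G)"
    and P: "P \<lhd> G" "prime (card P)" "card P \<ge> 3"
    and K: "subgroup K G" "K \<inter> P = {\<one>}" "card P * card K = order G"
    and cyc: "cyclic_group (G\<lparr>carrier := K\<rparr>)" and ncyc: "\<not> cyclic_group G"
  shows "3 * card {H. subgroup H G \<and> H \<subseteq> K} \<le> num_subgroups G"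
proof -
  have sP: "subgroup P G" using P(1) by (rule normal_imp_subgroup)
  have Pc: "x \<in> carrier G" if "x \<in> P" for x using that subgroup.mem_carrier[OF sP] by simp
  have Kc: "k \<in> carrier G" if "k \<in> K" for k using that subgroup.mem_carrier[OF K(1)] by simp
  interpret KG: group "G\<lparr>carrier := K\<rparr>" using K(1) by (rule subgroup_imp_group)
  have finK: "finite (carrier (G\<lparr>carrier := K\<rparr>))" using fin subgroup.subset[OF K(1)] finite_subset by auto
  have finP: "finite P" using P(2) by (metis card.infinite not_prime_0)
  have cop: "coprime (card P) (card K)"
    using sf K(3) by (metis squarefree_mult_imp_coprime_nat)
  define S where "S = {H. subgroup H G \<and> H \<subseteq> K}"
  have finS: "finite S" unfolding S_def using finite_subgroups[OF fin] by (rule rev_finite_subset) auto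
  have SK: "subgroup H (G\<lparr>carrier := K\<rparr>)" if "H \<in> S" for H
    using that subgroup_incl[OF _ K(1)] by (simp add: S_def)
  have card_inj: "H = L" if "H \<in> S" "L \<in> S" "card H = card L" for H L
    using that KG.subgroup_cyclic_eq_root_set[OF finK cyc] SK by metis
  define C where "C = {k \<in> K. \<forall>x\<in>P. x \<otimes> k = k \<otimes> x}"
  have C_Int: "C = K \<inter> (\<Inter>x\<in>P. centralizer G x)"
    using Kc by (auto simp: C_def centralizer_def)
  have sC: "subgroup C G"
    unfolding C_Int using subgroup.one_closed[OF sP] subgroup_centralizer Pc
    by (intro subgroups_Inter_pair K(1) subgroups_Inter) auto
  \<comment> \<open>If all of \<open>K\<close> centralized \<open>P\<close>, commuting cyclic
    factors of coprime order would make \<open>G\<close> cyclic.\<close>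
  have "C \<noteq> K"
  proof
    assume "C = K"
    hence "cyclic_group G"
      using cyclic_group_mult_complement[OF fin P(1,2) K cop cyc] by (auto simp: C_def)
    thus False using ncyc by simp
  qed
  have CK: "C \<subseteq> K" by (auto simp: C_def)
  have cC: "card C dvd card K"
    using KG.subgroup_card_dvd_order[OF subgroup_incl[OF sC K(1) CK]] by (simp add: order_def)
  have cCK: "card C \<noteq> card K" using \<open>C \<noteq> K\<close> CK finK by (metis card_subset_eq partial_object.select_convs(1) partial_object.surjective partial_object.update_convs(1))
  have sfK: "squarefree (card K)" using sf K(3) squarefree_mono by (metis dvd_triv_right)
  have c0: "card C > 0" using sfK cC by (metis dvd_0_left not_squarefree_0 neq0_conv)
  define B where "B = {H \<in> S. H \<subseteq> C}"
  have "card B \<le> card {H. subgroup H (G\<lparr>carrier := K\<rparr>) \<and> card H dvd card C}"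
  proof (rule card_mono)
    show "finite {H. subgroup H (G\<lparr>carrier := K\<rparr>) \<and> card H dvd card C}"
      using KG.finite_subgroups[OF finK] by (rule rev_finite_subset) auto
    interpret CG: group "G\<lparr>carrier := C\<rparr>" using sC by (rule subgroup_imp_group)
    show "B \<subseteq> {H. subgroup H (G\<lparr>carrier := K\<rparr>) \<and> card H dvd card C}"
    proof
      fix H assume H: "H \<in> B"
      hence "subgroup H (G\<lparr>carrier := C\<rparr>)" using subgroup_incl[OF _ sC] by (simp add: B_def S_def)
      hence "card H dvd card C" using CG.subgroup_card_dvd_order by (fastforce simp: order_def)
      thus "H \<in> {H. subgroup H (G\<lparr>carrier := K\<rparr>) \<and> card H dvd card C}" using H SK by (simp add: B_def)
    qed
  qed
  also have "\<dots> \<le> card {d. d dvd card C}" using KG.card_subgroups_cyclic_le[OF finK cyc c0] .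
  finally have "2 * card B \<le> card {d. d dvd card K}"
    using card_divisors_proper_squarefree[OF sfK cC cCK] by simp
  also have "\<dots> \<le> card S"
    using KG.card_divisors_le_num_subgroups[OF finK] num_subgroups_restrict[OF K(1)] by (simp add: order_def S_def)
  finally have B_le: "2 * card B \<le> card S" .
  have BS: "B \<subseteq> S" by (auto simp: B_def)
  have cSB: "card S = card B + card (S - B)"
    using BS finS by (metis card_Diff_subset card_mono finite_subset le_add_diff_inverse)
  define f where "f = (\<lambda>(x, H). (\<lambda>h. x \<otimes> h \<otimes> inv x) ` H)"
  have SP: "H \<inter> P \<subseteq> {\<one>}" if "H \<in> S" for H using that K(2) by (auto simp: S_def)
  have Sc: "H \<subseteq> carrier G" if "H \<in> S" for H using that Kc by (auto simp: S_def)
  have cardf: "card (f (x, H)) = card H" if "x \<in> P" "H \<in> S" for x H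
    using that Sc card_conj_image Pc by (simp add: f_def)
  have injf: "inj_on f (P \<times> (S - B))"
  proof (rule inj_onI, clarify)
    fix x H y L assume *: "x \<in> P" "y \<in> P" "H \<in> S" "H \<notin> B" "L \<in> S" "L \<notin> B" "f (x, H) = f (y, L)"
    \<comment> \<open>Conjugation preserves the order, which determines a subgroup of the cyclic
      group \<open>K\<close>; so only conjugates of the same subgroup could coincide.\<close>
    have "card H = card L" using cardf[OF *(1,3)] cardf[OF *(2,5)] *(7) by simp
    hence HL: "H = L" by (rule card_inj[OF *(3,5)])
    have sH: "subgroup H G" using *(3) by (simp add: S_def)
    have eq: "(\<lambda>h. x \<otimes> h \<otimes> inv x) ` H = (\<lambda>h. y \<otimes> h \<otimes> inv y) ` H"
      using *(7) by (simp add: f_def HL)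
    have "x = y"
    proof (rule ccontr)
      assume "x \<noteq> y"
      hence "u \<otimes> h = h \<otimes> u" if "h \<in> H" "u \<in> P" for h u
        using conj_subgroup_eq_imp_centralizes[OF P(1,2) sH SP[OF *(3)] *(1,2) _ eq that] by blast
      hence "H \<in> B" using *(3) by (auto simp: B_def C_def S_def)
      thus False using * by simp
    qed
    thus "x = y \<and> H = L" using HL by simp
  qed
  \<comment> \<open>A conjugate of \<open>H\<close> lying in \<open>B\<close> would be a subgroup of
    \<open>K\<close> of the same order as \<open>H\<close>, hence \<open>H\<close> itself, which is
    not in \<open>B\<close>.\<close>
  have disj: "B \<inter> f ` (P \<times> (S - B)) = {}"
  proof -
    have False if "x \<in> P" "H \<in> S" "H \<notin> B" "f (x, H) \<in> B" for x H
    proof -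
      have "f (x, H) \<in> S" using that BS by blast
      hence "f (x, H) = H" using card_inj[OF _ that(2)] cardf[OF that(1,2)] by blast
      thus False using that by simp
    qed
    thus ?thesis by auto
  qed
  have P1: "P \<noteq> {\<one>}" using P(2) by auto
  have "B \<union> f ` (P \<times> (S - B)) \<subseteq> {H. subgroup H G \<and> \<not> P \<subseteq> H}"
  proof (intro Un_least subsetI)
    fix H assume "H \<in> B"
    hence H: "H \<in> S" using BS by blast
    have "\<not> P \<subseteq> H" using SP[OF H] P1 subgroup.one_closed[OF sP] by blast
    thus "H \<in> {H. subgroup H G \<and> \<not> P \<subseteq> H}" using H by (simp add: S_def)
  next
    fix L assume "L \<in> f ` (P \<times> (S - B))"
    then obtain x H where x: "x \<in> P" "H \<in> S" "L = f (x, H)" by auto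
    have "subgroup L G" using x subgroup_conj Pc by (simp add: f_def S_def)
    moreover have "\<not> P \<subseteq> L"
    proof
      assume PL: "P \<subseteq> L"
      have "card P dvd card L"
      proof -
        interpret LG: group "G\<lparr>carrier := L\<rparr>" using \<open>subgroup L G\<close> by (rule subgroup_imp_group)
        show ?thesis using LG.subgroup_card_dvd_order[OF subgroup_incl[OF sP \<open>subgroup L G\<close> PL]] by (simp add: order_def)
      qed
      also have "card L = card H" using x cardf by simp
      also have "card H dvd card K" using KG.subgroup_card_dvd_order[OF SK[OF x(2)]] by (simp add: order_def)
      finally have "card P dvd 1" using cop by (metis coprime_common_divisor dvd_refl)
      thus False using P(3) by simp
    qed
    ultimately show "L \<in> {H. subgroup H G \<and> \<not> P \<subseteq> H}" by simp
  qed
  hence "card (B \<union> f ` (P \<times> (S - B))) \<le> card {H. subgroup H G \<and> \<not> P \<subseteq> H}"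
    using rev_finite_subset[OF finite_subgroups[OF fin]] by (intro card_mono) auto
  moreover have "card (B \<union> f ` (P \<times> (S - B))) = card B + card P * card (S - B)"
    using disj injf finS BS finP finite_subset
    by (subst card_Un_disjoint) (auto simp: card_image card_cartesian_product)
  moreover have "3 * card (S - B) \<le> card P * card (S - B)" using P(3) by simp
  \<comment> \<open>With \<open>s = card S\<close> and \<open>card B\<close> at most
    \<open>s / 2\<close>, this sum is \<open>3 * s - 2 * card B\<close>, at least
    \<open>2 * s\<close>. The subgroups containing \<open>P\<close> contribute another
    \<open>s\<close>.\<close>
  ultimately have "card B + 3 * card (S - B) \<le> card {H. subgroup H G \<and> \<not> P \<subseteq> H}" by linarith
  moreover have "card S \<le> card {H. subgroup H G \<and> P \<subseteq> H}"
    unfolding S_def by (rule card_subgroups_above_normal[OF fin P(1) K(1,2)])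
  ultimately have "3 * card S \<le> num_subgroups G"
    using num_subgroups_split[OF fin, of P] cSB B_le by simp
  thus ?thesis by (simp add: S_def)
qed

text \<open>For the largest prime \<open>p\<close>, the equation \<open>x^p = 1\<close> has exactly
  \<open>p\<close> solutions, so they fill the cyclic subgroup generated by an element of order
  \<open>p\<close>. A solution set is invariant under conjugation, which makes this subgroup
  normal.\<close>

lemma squarefree_largest_prime_complement:
  assumes fin: "finite (carrier G)" and sf: "squarefree (order G)" and n1: "order G \<noteq> 1"
  obtains P K where "P \<lhd> G" "prime (card P)" "subgroup K G" "K \<inter> P = {\<one>}"
    "card P * card K = order G" "\<And>q. prime q \<Longrightarrow> q dvd order G \<Longrightarrow> q \<le> card P"
proof -
  have n0: "order G > 0" using fin order_gt_0_iff_finite by simp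
  define p where "p = Max (prime_factors (order G))"
  have "prime_factors (order G) \<noteq> {}" using n1 n0 prime_factor_nat[of "order G"] by (auto simp: prime_factors_dvd)
  hence "p \<in> prime_factors (order G)" unfolding p_def by (intro Max_in) auto
  hence p: "prime p" "p dvd order G" by auto
  have pmax: "q \<le> p" if "prime q" "q dvd order G" for q
    unfolding p_def using that n0 by (intro Max_ge) (auto simp: prime_factors_dvd)
  have np: "order G = p * (order G div p)" using p by simp
  have cop: "coprime p (order G div p)" using sf np by (metis squarefree_mult_imp_coprime_nat)
  have card: "card (root_set G p) = p"
  proof (rule card_root_set_upper_hall[OF fin sf p(2)])
    fix q r assume qr: "prime q" "prime r" "q dvd p" "r dvd order G div p"
    have "q = p" using qr p primes_dvd_imp_eq by blast
    moreover have "r \<le> p" using pmax qr np by (metis dvd_mult)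
    moreover have "r \<noteq> p" using cop qr p by (metis coprime_common_divisor dvd_refl not_prime_unit)
    ultimately show "r < q" by simp
  qed
  obtain x where x: "x \<in> carrier G" "ord x = p" using obtain_ord_eq_prime[OF fin p] .
  define P where "P = generate G {x}"
  have sP: "subgroup P G" unfolding P_def using x by (intro generate_is_subgroup) auto
  have cP: "card P = p" using x generate_pow_card by (simp add: P_def)
  interpret PG: group "G\<lparr>carrier := P\<rparr>" using sP by (rule subgroup_imp_group)
  have "P \<subseteq> root_set G p"
    using PG.pow_order_eq_1 subgroup.mem_carrier[OF sP] cP
    by (auto simp: root_set_def order_def nat_pow_consistent[symmetric])
  hence PR: "P = root_set G p" using card cP finite_root_set[OF fin] by (metis card_subset_eq)
  have normal: "P \<lhd> G" unfolding normal_inv_iff using sP conj_root_set PR by blast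
  have ab: "a \<otimes> b = b \<otimes> a" if abP: "a \<in> P" "b \<in> P" for a b
  proof -
    obtain i j :: nat where "a = x [^] i" "b = x [^] j"
      using abP generate_pow_on_finite_carrier[OF fin x(1)] unfolding P_def by blast
    thus ?thesis using x by (simp add: nat_pow_mult add.commute)
  qed
  show ?thesis
    using abelian_normal_complement[OF fin normal ab] cop that normal cP p pmax by metis
qed

end

section \<open>Induction on squarefree orders and conclusion\<close>

theorem num_subgroups_squarefree_noncyclic:
  fixes G :: "('a, 'b) monoid_scheme"
  assumes "group G" "finite (carrier G)" "squarefree (order G)" "\<not> cyclic_group G"
  shows "3 * 2 ^ card (prime_factors (order G)) \<le> 2 * num_subgroups G"
  using assms
proof (induction "order G" arbitrary: G rule: less_induct)
  case less
  interpret group G by fact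
  note fin = less.prems(2) and sf = less.prems(3) and ncyc = less.prems(4)
  have "order G \<noteq> 1"
  proof
    assume "order G = 1"
    hence "ord (one G) = order G" by simp
    thus False using ncyc cyclic_group_iff_ord[OF fin] one_closed by blast
  qed
  then obtain P K where PK: "P \<lhd> G" "prime (card P)" "subgroup K G" "K \<inter> P = {one G}"
    "card P * card K = order G" "\<And>q. prime q \<Longrightarrow> q dvd order G \<Longrightarrow> q \<le> card P"
    using squarefree_largest_prime_complement[OF fin sf] by blast
  let ?K = "G\<lparr>carrier := K\<rparr>"
  interpret KG: group ?K using PK(3) by (rule subgroup_imp_group)
  have finK: "finite (carrier ?K)" using fin subgroup.subset[OF PK(3)] finite_subset by auto
  have oK: "order ?K = card K" by (simp add: order_def)
  have n0: "order G > 0" using fin order_gt_0_iff_finite by simp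
  have K0: "card K > 0" using n0 PK(5) by (cases "card K") auto
  have cop: "coprime (card P) (card K)" using sf PK(5) by (metis squarefree_mult_imp_coprime_nat)
  have nd: "\<not> card P dvd card K" using cop PK(2) by (metis coprime_common_divisor dvd_refl not_prime_unit)
  have pf: "card (prime_factors (order G)) = Suc (card (prime_factors (card K)))"
    using card_prime_factors_prime_power_mult[OF PK(2) nd K0, of 1] PK(5) by simp
  show ?case
  proof (cases "cyclic_group ?K")
    case False
    have "1 * card K < card P * card K"
      using K0 prime_gt_1_nat[OF PK(2)] by (intro mult_strict_right_mono) auto
    hence "card K < order G" using PK(5) by simp
    moreover have "squarefree (card K)" using sf squarefree_mono[OF dvd_triv_right] unfolding PK(5)[symmetric] by blast
    ultimately have "3 * 2 ^ card (prime_factors (card K)) \<le> 2 * num_subgroups ?K"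
      using less.hyps[of ?K] finK False KG.is_group oK by simp
    moreover have "P \<noteq> {one G}" using PK(2) by auto
    ultimately show ?thesis
      using twice_card_subgroups_complement_le[OF fin PK(1) _ PK(3,4)] num_subgroups_restrict[OF PK(3)] pf by simp
  next
    case True
    \<comment> \<open>If 2 were the largest prime, the squarefree order would be 2 itself and
      \<open>G\<close> would be cyclic.\<close>
    have "card P \<noteq> 2"
    proof
      assume P2: "card P = 2"
      have "card K = 1"
      proof (rule ccontr)
        assume "card K \<noteq> 1"
        then obtain q where q: "prime q" "q dvd card K" using prime_factor_nat by blast
        hence "q \<le> 2" using PK(6)[of q] PK(5) P2 by (metis dvd_mult)
        hence "q = card P" using prime_ge_2_nat[OF q(1)] P2 by simp
        thus False using q nd by simp
      qed
      hence o: "order G = card P" using PK(5) by simp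
      obtain x where "x \<in> carrier G" "ord x = card P" using obtain_ord_eq_prime[OF fin PK(2)] o by auto
      thus False using ncyc cyclic_group_iff_ord[OF fin] o by auto
    qed
    hence "card P \<ge> 3" using prime_ge_2_nat[OF PK(2)] by simp
    hence "3 * num_subgroups ?K \<le> num_subgroups G"
      using thrice_card_subgroups_complement_le[OF fin sf PK(1,2) _ PK(3-5) True ncyc]
        num_subgroups_restrict[OF PK(3)] by simp
    \<comment> \<open>\<open>K\<close> has one prime fewer than \<open>G\<close>, so three times
      this bound is three halves of the power of 2 belonging to \<open>G\<close>.\<close>
    moreover have "2 ^ card (prime_factors (card K)) \<le> num_subgroups ?K"
      using card_divisors_ge[OF K0] KG.card_divisors_le_num_subgroups[OF finK] oK by simp
    ultimately show ?thesis using pf by simp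
  qed
qed

theorem theorem3p5:
  fixes G :: "('a, 'b) monoid_scheme"
  assumes "group G" and "finite (carrier G)"
    and "subgroup_ratio G < 3 / 2"
  shows "subgroup_ratio G = 1 \<and> cyclic_group G \<and> squarefree (order G)"
proof -
  interpret group G by fact
  note fin = assms(2)
  have n0: "order G > 0" using fin order_gt_0_iff_finite by simp
  define k where "k = card (prime_factors (order G))"
  have "2 * real (num_subgroups G) < 3 * 2 ^ k"
    using assms(3) by (simp add: subgroup_ratio_def num_primes_def k_def field_simps)
  hence "real (2 * num_subgroups G) < real (3 * 2 ^ k)" by simp
  hence lt: "2 * num_subgroups G < 3 * 2 ^ k" by (simp only: of_nat_less_iff)
  have rich: "card {d. d dvd order G} \<le> num_subgroups G" by (rule card_divisors_le_num_subgroups[OF fin])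
  have sf: "squarefree (order G)"
    using card_divisors_not_squarefree[OF n0] rich lt by (force simp: k_def)
  have cyc: "cyclic_group G"
    using num_subgroups_squarefree_noncyclic[OF assms(1) fin sf] lt by (force simp: k_def)
  \<comment> \<open>In a cyclic group the order determines the subgroup, so the number of divisors
    is also an upper bound. It meets Richards' lower bound, and squarefreeness turns it into
    \<open>2 ^ k\<close>.\<close>
  have "{H. subgroup H G} = {H. subgroup H G \<and> card H dvd order G}" using subgroup_card_dvd_order by blast
  hence "num_subgroups G \<le> card {d. d dvd order G}"
    using card_subgroups_cyclic_le[OF fin cyc n0] by (simp add: num_subgroups_def)
  hence "num_subgroups G = 2 ^ k" using rich card_divisors_squarefree[OF sf] by (simp add: k_def)
  thus ?thesis using sf cyc by (simp add: subgroup_ratio_def num_primes_def k_def)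
qed

end
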